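(* Let $(c_n)_{n\in\mathbb N}$ be a strictly positive, decreasing sequence with $\sum_{n\in\mathbb N}c_n=1$ such that $$\lim_{n\to\infty}\frac{-\log c_n}{\log n}=p$$ with $p\ge 1$. Let $(\vartheta_n)_{n\in\mathbb N}$ be independent random variables, each uniformly distributed on $[0,2\pi)$, put $\zeta_n=e^{i\vartheta_n}$, let $\mu=\sum_{n\in\mathbb N}c_n\delta_{\zeta_n}$, and let $\varphi$ be the associated random inner function $$\varphi(z)=\frac{H\mu(z)-1}{H\mu(z)+1},\qquad H\mu(z)=\int_{\mathbb T}\frac{\zeta+z}{\zeta-z}\,d\mu(\zeta),\qquad z\in\mathbb D.$$ Let $\Lambda=(\lambda_k)_{k\in\mathbb N}$ be the sequence of zeros of $\varphi$. Then for every $\varepsilon>0$, $$\sum_{k\in\mathbb N}(1-|\lambda_k|)^{2-p-\varepsilon}=\infty\quad\text{almost surely.}$$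
   Context: $\mathbb D$ is the open unit disk in $\mathbb C$, $\mathbb T=\partial\mathbb D$. An inner function is an analytic map $\mathbb D\to\mathbb D$ with radial limits of modulus $1$ at Lebesgue-almost every point of $\mathbb T$; the random function $\varphi$ in the claim is inner. Zeros in $\mathbb D$ are listed with multiplicity. *)

theory Defs
  imports "HOL-Probability.Probability" "HOL-Complex_Analysis.Complex_Analysis"
begin

definition atomic_measure :: "(nat \<Rightarrow> real) \<Rightarrow> (nat \<Rightarrow> complex) \<Rightarrow> complex measure"
  where "atomic_measure c \<zeta> =
    measure_of UNIV (sets borel) (\<lambda>A. \<Sum>n. ennreal (c n) * emeasure (return borel (\<zeta> n)) A)"

lemma sets_atomic_measure [simp]: "sets (atomic_measure c \<zeta>) = sets borel"
  and space_atomic_measure [simp]: "space (atomic_measure c \<zeta>) = UNIV"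
  using sets.sigma_sets_eq[of "borel :: complex measure"]
  by (simp_all add: atomic_measure_def sets_measure_of_conv space_measure_of_conv)

lemma emeasure_atomic_measure:
  assumes "A \<in> sets borel"
  shows "emeasure (atomic_measure c \<zeta>) A = (\<Sum>n. ennreal (c n) * indicator A (\<zeta> n))"
proof -
  let ?m = "\<lambda>A. \<Sum>n. ennreal (c n) * emeasure (return borel (\<zeta> n)) A"
  have "emeasure (atomic_measure c \<zeta>) A = ?m A"
  proof (rule emeasure_measure_of[OF atomic_measure_def])
    show "countably_additive (sets (atomic_measure c \<zeta>)) ?m"
    proof (rule countably_additiveI)
      fix B :: "nat \<Rightarrow> complex set"
      assume B: "range B \<subseteq> sets (atomic_measure c \<zeta>)" "disjoint_family B"
      have "(\<Sum>i. ?m (B i)) = (\<Sum>n. \<Sum>i. ennreal (c n) * emeasure (return borel (\<zeta> n)) (B i))"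
        using nn_integral_suminf[of "\<lambda>i n. ennreal (c n) * emeasure (return borel (\<zeta> n)) (B i)"
            "count_space UNIV"]
        by (simp add: nn_integral_count_space_nat del: ennreal_suminf_cmult)
      also have "\<dots> = ?m (\<Union>i. B i)"
        using B by (simp add: suminf_emeasure del: emeasure_return)
      finally show "(\<Sum>i. ?m (B i)) = ?m (\<Union>i. B i)" .
    qed
  qed (use assms in \<open>auto simp: positive_def\<close>)
  then show ?thesis
    using assms by simp
qed

definition herglotz :: "complex measure \<Rightarrow> complex \<Rightarrow> complex"
  where "herglotz \<mu> z = (LINT \<zeta>:sphere 0 1|\<mu>. (\<zeta> + z) / (\<zeta> - z))"

definition inner_of :: "complex measure \<Rightarrow> complex \<Rightarrow> complex"
  where "inner_of \<mu> z = (herglotz \<mu> z - 1) / (herglotz \<mu> z + 1)"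

text \<open>\<open>\<Lambda>\<close> lists the zeros of \<open>f\<close> in the unit disk, each repeated according to its multiplicity.
  At a zero of an analytic \<open>f\<close> that does not vanish identically, \<open>zorder\<close> is positive, so the
  cardinality condition forces each zero to occur finitely often (an infinite set has \<open>card\<close> 0).\<close>

definition zero_sequence :: "(complex \<Rightarrow> complex) \<Rightarrow> (nat \<Rightarrow> complex) \<Rightarrow> bool"
  where "zero_sequence f \<Lambda> \<longleftrightarrow>
    range \<Lambda> = {z \<in> ball 0 1. f z = 0} \<and>
    (\<forall>z \<in> ball 0 1. f z = 0 \<longrightarrow> int (card {k. \<Lambda> k = z}) = zorder f z)"

end

theory Submission
  imports Defs
begin

text \<open>
  Write \<open>F z = (\<Sum>m. c m / (\<zeta> m - z))\<close> for the Cauchy transform of the measure. As the weights sum to \<open>1\<close>, the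
  Herglotz transform is \<open>1 + 2 * z * F z\<close>, so every zero of \<open>F\<close> in the disk is a zero of the
  inner function. The idea is that most atoms have their own zero of \<open>F\<close> at a height
  comparable to their mass. Near \<open>\<zeta> n\<close>, at scale \<open>c n\<close>, the other atoms contribute to the Herglotz transform
  approximately a purely imaginary constant \<open>\<i> * V\<close>. Solving the equation with this constant in place of the other
  atoms gives a zero at height about \<open>2 * c n / (1 + V\<^sup>2)\<close>. If \<open>V\<close> is bounded and the others really are
  nearly constant there, a fixed point argument turns this into a true zero
  (\<open>good_atom_imp_zero\<close>), and different atoms yield different zeros (\<open>zeros_of_good_atoms_distinct\<close>).
  Hence \<open>\<Sum>k. (1 - \<bar>\<Lambda> k\<bar>) powr s\<close> diverges as soon as the sum of \<open>c n powr s\<close> over these good atoms does.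

  An atom is good with probability close to \<open>1\<close>. Only its own position is random here, the others being
  fixed, so the probability is an average over a circle, and the averages that
  occur are mean values of analytic functions. The constant \<open>V\<close> exceeds \<open>K\<close> with probability \<open>O(1 / K)\<close>
  (\<open>herglotz_tightness\<close>). The influence of the \<open>m\<close>-th atom on the \<open>n\<close>-th, truncated at \<open>1\<close>, has mean of order at most
  \<open>min (c m) (sqrt (c n))\<close> (\<open>nn_integral_truncated_interaction\<close>), and by Tannery's theorem the sum over \<open>m\<close> tends to
  \<open>0\<close> as \<open>n\<close> grows.

  For \<open>s = 2 - p - \<epsilon>\<close> the sum of all \<open>c n powr s\<close> diverges (\<open>not_summable_powr\<close>), because \<open>x * (2 - x) \<le> 1\<close>
  for \<open>x = p + \<epsilon>\<close>. As each late term is kept with probability at least \<open>1 - 7 / K\<close>, the sum over the good atoms diverges with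
  at least this probability (\<open>prob_weighted_series_finite_le\<close>); letting \<open>K\<close> grow gives divergence almost surely.
\<close>

section \<open>Cauchy and Herglotz transforms of atomic measures on the circle\<close>

definition herglotz_sum :: "(nat \<Rightarrow> real) \<Rightarrow> (nat \<Rightarrow> complex) \<Rightarrow> complex \<Rightarrow> complex"
  where "herglotz_sum c \<zeta> z = (\<Sum>m. complex_of_real (c m) * ((\<zeta> m + z) / (\<zeta> m - z)))"

definition cauchy_sum :: "(nat \<Rightarrow> real) \<Rightarrow> (nat \<Rightarrow> complex) \<Rightarrow> complex \<Rightarrow> complex"
  where "cauchy_sum c \<zeta> z = (\<Sum>m. complex_of_real (c m) / (\<zeta> m - z))"

lemma Re_herglotz_kernel:
  assumes "norm a = 1"
  shows "Re ((a + z) / (a - z)) = (1 - (norm z)\<^sup>2) / (norm (a - z))\<^sup>2"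
proof -
  have "Re ((a + z) / (a - z)) = Re ((a + z) * cnj (a - z)) / (norm (a - z))\<^sup>2"
    by (simp add: complex_div_cnj[of "a + z"] flip: of_real_power)
  also have "Re ((a + z) * cnj (a - z)) = (norm a)\<^sup>2 - (norm z)\<^sup>2"
    unfolding cmod_power2 by (simp add: power2_eq_square algebra_simps)
  finally show ?thesis
    using assms by simp
qed

text \<open>Zero weights are admitted so that deleting an atom, that is, replacing its weight by \<open>0\<close>,
  stays inside the locale.\<close>

locale circle_weights =
  fixes c :: "nat \<Rightarrow> real" and \<zeta> :: "nat \<Rightarrow> complex"
  assumes weight_nonneg: "0 \<le> c m"
    and summable_weights: "summable c"
    and norm_atom [simp]: "norm (\<zeta> m) = 1"
begin

lemma dist_atom_ge: "1 - norm z \<le> norm (\<zeta> m - z)"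
  using norm_triangle_ineq2[of "\<zeta> m" z] by simp

lemma atom_neq: "norm z < 1 \<Longrightarrow> \<zeta> m \<noteq> z"
  by (metis less_irrefl norm_atom)

lemma norm_cauchy_term_le:
  assumes "norm z \<le> r" "r < 1"
  shows "norm (complex_of_real (c m) / (\<zeta> m - z)) \<le> c m / (1 - r)"
proof -
  have "1 - r \<le> norm (\<zeta> m - z)"
    using dist_atom_ge[of z m] assms by linarith
  then show ?thesis
    using assms weight_nonneg[of m]
    by (simp add: norm_divide frac_le)
qed

lemma summable_cauchy:
  assumes "norm z < 1"
  shows "summable (\<lambda>m. complex_of_real (c m) / (\<zeta> m - z))"
proof (rule summable_comparison_test')
  show "summable (\<lambda>m. c m / (1 - norm z))"
    using summable_weights by (rule summable_divide)
  show "norm (complex_of_real (c m) / (\<zeta> m - z)) \<le> c m / (1 - norm z)" if "m \<ge> 0" for m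
    using norm_cauchy_term_le[of z "norm z"] assms by simp
qed

lemma summable_weighted_inverse_square:
  assumes "norm z < 1"
  shows "summable (\<lambda>m. a * c m / (norm (\<zeta> m - z))\<^sup>2)"
proof -
  have "summable (\<lambda>m. c m / (norm (\<zeta> m - z))\<^sup>2)"
  proof (rule summable_comparison_test')
    show "summable (\<lambda>m. c m / (1 - norm z)\<^sup>2)"
      using summable_weights by (rule summable_divide)
    show "norm (c m / (norm (\<zeta> m - z))\<^sup>2) \<le> c m / (1 - norm z)\<^sup>2" if "m \<ge> 0" for m
      using dist_atom_ge[of z m] assms weight_nonneg[of m]
      by (auto intro!: divide_left_mono power_mono mult_pos_pos simp: atom_neq)
  qed
  then show ?thesis
    using summable_mult[of _ a] by fastforce
qed

lemma herglotz_term_eq: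
  assumes "norm z < 1"
  shows "complex_of_real (c m) * ((\<zeta> m + z) / (\<zeta> m - z))
    = complex_of_real (c m) + 2 * z * (complex_of_real (c m) / (\<zeta> m - z))"
  using atom_neq[OF assms, of m] by (simp add: field_simps)

lemma sums_herglotz:
  assumes "norm z < 1"
  shows "(\<lambda>m. complex_of_real (c m) * ((\<zeta> m + z) / (\<zeta> m - z))) sums
    (complex_of_real (suminf c) + 2 * z * cauchy_sum c \<zeta> z)"
  unfolding herglotz_term_eq[OF assms] cauchy_sum_def
  by (intro sums_add sums_mult sums_of_real summable_sums summable_weights summable_cauchy assms)

lemma herglotz_eq_cauchy:
  "norm z < 1 \<Longrightarrow> herglotz_sum c \<zeta> z = complex_of_real (suminf c) + 2 * z * cauchy_sum c \<zeta> z"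
  using sums_unique[OF sums_herglotz] by (simp add: herglotz_sum_def)

lemma herglotz_0: "herglotz_sum c \<zeta> 0 = complex_of_real (suminf c)"
  by (simp add: herglotz_eq_cauchy)

text \<open>The real part of the Herglotz transform is the Poisson integral of the measure.\<close>

lemma Re_herglotz_sums:
  assumes "norm z < 1"
  shows "(\<lambda>m. (1 - (norm z)\<^sup>2) * c m / (norm (\<zeta> m - z))\<^sup>2) sums Re (herglotz_sum c \<zeta> z)"
proof -
  have *: "Re (complex_of_real (c m) * ((\<zeta> m + z) / (\<zeta> m - z)))
      = (1 - (norm z)\<^sup>2) * c m / (norm (\<zeta> m - z))\<^sup>2" for m
    using Re_herglotz_kernel[OF norm_atom, of m z]
    by (simp only: times_complex.sel Re_complex_of_real Im_complex_of_real) simp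
  show ?thesis
    using sums_Re[OF sums_herglotz[OF assms]] unfolding * herglotz_eq_cauchy[OF assms] .
qed

lemma Re_herglotz_nonneg:
  assumes "norm z < 1"
  shows "0 \<le> Re (herglotz_sum c \<zeta> z)"
proof -
  have "(norm z)\<^sup>2 \<le> 1"
    using assms by (simp add: power_le_one)
  then show ?thesis
    using weight_nonneg by (intro sums_le[OF _ sums_zero Re_herglotz_sums[OF assms]]) simp
qed

lemma holomorphic_cauchy_sum: "cauchy_sum c \<zeta> holomorphic_on ball 0 1"
proof (rule holomorphic_uniform_sequence[OF open_ball])
  show "(\<lambda>z. \<Sum>m<n. complex_of_real (c m) / (\<zeta> m - z)) holomorphic_on ball 0 1" for n
    by (intro holomorphic_intros) (auto simp: atom_neq)
  fix x :: complex
  assume x: "x \<in> ball 0 1"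
  define d where "d = (1 - norm x) / 2"
  have norm_le: "norm z \<le> norm x + d" if "z \<in> cball x d" for z
    using that norm_triangle_ineq[of x "z - x"] by (simp add: dist_norm norm_minus_commute)
  have d: "d > 0" "norm x + d < 1"
    using x by (auto simp: d_def field_simps)
  have "uniform_limit (cball x d) (\<lambda>n z. \<Sum>m<n. complex_of_real (c m) / (\<zeta> m - z))
      (\<lambda>z. \<Sum>m. complex_of_real (c m) / (\<zeta> m - z)) sequentially"
    by (rule Weierstrass_m_test[of _ _ "\<lambda>m. c m / (1 - (norm x + d))"])
      (use norm_le d summable_weights norm_cauchy_term_le in \<open>auto intro!: summable_divide\<close>)
  moreover have "cball x d \<subseteq> ball 0 1"
    using norm_le d by fastforce
  ultimately show "\<exists>d>0. cball x d \<subseteq> ball 0 1 \<and> uniform_limit (cball x d)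
      (\<lambda>n z. \<Sum>m<n. complex_of_real (c m) / (\<zeta> m - z)) (cauchy_sum c \<zeta>) sequentially"
    using d by (intro exI[of _ d]) (simp add: cauchy_sum_def[abs_def])
qed

lemma holomorphic_herglotz_sum: "herglotz_sum c \<zeta> holomorphic_on ball 0 1"
proof (rule holomorphic_transform)
  show "(\<lambda>z. complex_of_real (suminf c) + 2 * z * cauchy_sum c \<zeta> z) holomorphic_on ball 0 1"
    by (intro holomorphic_intros holomorphic_cauchy_sum)
qed (simp add: herglotz_eq_cauchy)

text \<open>The atomic measure is the image of a weighted counting measure under the enumeration of the atoms,
  which turns the Lebesgue integral into a series.\<close>

lemma herglotz_atomic_measure:
  assumes "norm z < 1"
  shows "herglotz (atomic_measure c \<zeta>) z = herglotz_sum c \<zeta> z"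
proof -
  let ?N = "density (count_space UNIV) (\<lambda>n. ennreal (c n))"
  let ?f = "\<lambda>x. indicator (sphere 0 1) x *\<^sub>R ((x + z) / (x - z))"
  have \<mu>: "atomic_measure c \<zeta> = distr ?N borel \<zeta>"
  proof (rule measure_eqI)
    fix A assume "A \<in> sets (atomic_measure c \<zeta>)"
    then have A: "A \<in> sets borel" by simp
    then have "emeasure (distr ?N borel \<zeta>) A
        = (\<integral>\<^sup>+n. ennreal (c n) * indicator (\<zeta> -` A) n \<partial>count_space UNIV)"
      by (simp add: emeasure_distr emeasure_density)
    also have "\<dots> = (\<Sum>n. ennreal (c n) * indicator (\<zeta> -` A) n)"
      by (rule nn_integral_count_space_nat)
    also have "\<dots> = emeasure (atomic_measure c \<zeta>) A"
      by (simp add: emeasure_atomic_measure[OF A] indicator_def)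
    finally show "emeasure (atomic_measure c \<zeta>) A = emeasure (distr ?N borel \<zeta>) A" ..
  qed simp
  have [measurable]: "sphere 0 1 \<in> sets (borel :: complex measure)"
    by (intro borel_closed closed_sphere)
  have [measurable]: "?f \<in> borel_measurable borel"
    by measurable
  have "herglotz (atomic_measure c \<zeta>) z = (LINT x|distr ?N borel \<zeta>. ?f x)"
    by (simp add: herglotz_def set_lebesgue_integral_def \<mu>)
  also have "\<dots> = (LINT n|?N. ?f (\<zeta> n))"
    by (rule integral_distr) auto
  also have "\<dots> = (LINT n|count_space UNIV. c n *\<^sub>R ?f (\<zeta> n))"
    by (rule integral_density) (auto simp: weight_nonneg)
  also have "\<dots> = (\<Sum>n. c n *\<^sub>R ?f (\<zeta> n))"
  proof (rule integral_count_space_nat)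
    have "norm (c n *\<^sub>R ?f (\<zeta> n)) \<le> c n * (2 / (1 - norm z))" for n
    proof -
      have "norm (\<zeta> n + z) \<le> 2"
        using norm_triangle_ineq[of "\<zeta> n" z] assms by simp
      then have "norm ((\<zeta> n + z) / (\<zeta> n - z)) \<le> 2 / (1 - norm z)"
        unfolding norm_divide using dist_atom_ge[of z n] assms by (intro frac_le) auto
      from mult_left_mono[OF this weight_nonneg[of n]] show ?thesis
        by (simp add: weight_nonneg)
    qed
    then have "summable (\<lambda>n. norm (c n *\<^sub>R ?f (\<zeta> n)))"
      by (intro summable_comparison_test'[OF summable_mult2[OF summable_weights, of "2 / (1 - norm z)"]])
        (simp only: real_norm_def abs_norm_cancel)
    then show "integrable (count_space UNIV) (\<lambda>n. c n *\<^sub>R ?f (\<zeta> n))"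
      by (simp only: integrable_count_space_nat_iff)
  qed
  also have "\<dots> = herglotz_sum c \<zeta> z"
    by (simp add: herglotz_sum_def scaleR_conv_of_real)
  finally show ?thesis .
qed

end

section \<open>A zero beside every good atom\<close>

context circle_weights
begin

lemma circle_weights_remove: "circle_weights (c(n := 0)) \<zeta>"
proof
  show "summable (c(n := 0))"
    using summable_weights by (rule summable_comparison_test'[where N = 0]) (auto simp: weight_nonneg)
qed (auto simp: weight_nonneg)

lemma suminf_remove: "suminf (c(n := 0)) = suminf c - c n"
proof -
  have "(\<lambda>m. c m - (if m = n then c m else 0)) sums (suminf c - c n)"
    by (intro sums_diff summable_sums summable_weights sums_single)
  also have "(\<lambda>m. c m - (if m = n then c m else 0)) = c(n := 0)"
    by auto
  finally show ?thesis
    by (rule sums_unique[symmetric])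
qed

lemma cauchy_sum_split:
  assumes "norm z < 1"
  shows "cauchy_sum c \<zeta> z = complex_of_real (c n) / (\<zeta> n - z) + cauchy_sum (c(n := 0)) \<zeta> z"
proof -
  interpret rest: circle_weights "c(n := 0)" \<zeta>
    by (rule circle_weights_remove)
  have "(\<lambda>m. (if m = n then complex_of_real (c m) / (\<zeta> m - z) else 0)
      + complex_of_real ((c(n := 0)) m) / (\<zeta> m - z))
    sums (complex_of_real (c n) / (\<zeta> n - z) + cauchy_sum (c(n := 0)) \<zeta> z)"
    unfolding cauchy_sum_def
    by (intro sums_add sums_single summable_sums rest.summable_cauchy assms)
  also have "(\<lambda>m. (if m = n then complex_of_real (c m) / (\<zeta> m - z) else 0)
      + complex_of_real ((c(n := 0)) m) / (\<zeta> m - z)) = (\<lambda>m. complex_of_real (c m) / (\<zeta> m - z))"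
    by auto
  finally show ?thesis
    unfolding cauchy_sum_def by (rule sums_unique[symmetric])
qed

text \<open>The difference of two terms carries the factor
  \<open>1 / (\<bar>\<zeta> m - z\<bar> \<bar>\<zeta> m - w\<bar>)\<close>. When \<open>z\<close> is, up to the factor \<open>L\<close>, no closer to the atoms than \<open>w\<close>,
  this gives a bound that depends on \<open>w\<close> alone, hence one that is uniform in \<open>z\<close>.\<close>

lemma cauchy_sum_oscillation:
  assumes z: "norm z < 1" and w: "norm w < 1"
    and L: "\<And>m. norm (\<zeta> m - w) \<le> L * norm (\<zeta> m - z)"
  shows "norm (cauchy_sum c \<zeta> z - cauchy_sum c \<zeta> w)
    \<le> L * norm (z - w) * (\<Sum>m. c m / (norm (\<zeta> m - w))\<^sup>2)"
proof -
  let ?t = "\<lambda>m. complex_of_real (c m) / (\<zeta> m - z) - complex_of_real (c m) / (\<zeta> m - w)"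
  have sm: "summable (\<lambda>m. c m / (norm (\<zeta> m - w))\<^sup>2)"
    using summable_weighted_inverse_square[OF w, of 1] by simp
  have le: "norm (?t m) \<le> L * norm (z - w) * (c m / (norm (\<zeta> m - w))\<^sup>2)" for m
  proof -
    have pos: "0 < norm (\<zeta> m - z)" "0 < norm (\<zeta> m - w)"
      using atom_neq[OF z, of m] atom_neq[OF w, of m] by auto
    have "?t m = complex_of_real (c m) * (z - w) / ((\<zeta> m - z) * (\<zeta> m - w))"
      using pos by (simp add: field_simps)
    then have "norm (?t m) = c m * norm (z - w) / (norm (\<zeta> m - z) * norm (\<zeta> m - w))"
      by (simp add: norm_mult norm_divide weight_nonneg)
    also have "\<dots> = c m * norm (z - w) * (norm (\<zeta> m - w) / norm (\<zeta> m - z)) / (norm (\<zeta> m - w))\<^sup>2"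
      using pos by (simp add: field_simps power2_eq_square)
    also have "\<dots> \<le> c m * norm (z - w) * L / (norm (\<zeta> m - w))\<^sup>2"
      using L[of m] pos weight_nonneg[of m]
      by (intro divide_right_mono mult_left_mono) (auto simp: divide_le_eq)
    finally show ?thesis
      by (simp add: mult_ac)
  qed
  have s: "summable (\<lambda>m. norm (?t m))"
    by (rule summable_comparison_test'[OF summable_mult[OF sm]]) (use le in auto)
  have "cauchy_sum c \<zeta> z - cauchy_sum c \<zeta> w = (\<Sum>m. ?t m)"
    unfolding cauchy_sum_def by (rule suminf_diff[OF summable_cauchy[OF z] summable_cauchy[OF w]])
  also have "norm \<dots> \<le> (\<Sum>m. norm (?t m))"
    by (rule summable_norm[OF s])
  also have "\<dots> \<le> (\<Sum>m. L * norm (z - w) * (c m / (norm (\<zeta> m - w))\<^sup>2))"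
    by (rule suminf_le[OF le s summable_mult[OF sm]])
  also have "\<dots> = L * norm (z - w) * (\<Sum>m. c m / (norm (\<zeta> m - w))\<^sup>2)"
    by (rule suminf_mult[OF sm])
  finally show ?thesis .
qed

end

text \<open>The point at height \<open>c n\<close> above the atom \<open>\<zeta> n\<close>: the scale on which this atom alone makes
  the Poisson integral of order one.\<close>

definition base_point :: "(nat \<Rightarrow> real) \<Rightarrow> (nat \<Rightarrow> complex) \<Rightarrow> nat \<Rightarrow> complex"
  where "base_point c \<zeta> n = complex_of_real (1 - c n) * \<zeta> n"

text \<open>Up to a factor between \<open>1\<close> and \<open>2\<close> this is the Poisson integral, at the base point of the \<open>n\<close>-th
  atom, of all the other atoms. It also controls the oscillation of their Cauchy transform at the
  scale \<open>c n\<close>.\<close>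

definition interaction :: "(nat \<Rightarrow> real) \<Rightarrow> (nat \<Rightarrow> complex) \<Rightarrow> nat \<Rightarrow> real"
  where "interaction c \<zeta> n =
    (\<Sum>m. c n * (c(n := 0)) m / (norm (\<zeta> m - base_point c \<zeta> n))\<^sup>2)"

text \<open>If the rest of the measure has Herglotz transform of modulus at most \<open>K\<close> at the base point, then the
  zero beside an atom of mass \<open>c n\<close> has height at least \<open>height_const K * c n\<close>; the isolation
  constant is the safety factor that makes the other atoms negligible against this height.\<close>

definition height_const :: "real \<Rightarrow> real"
  where "height_const K = 1 / (8 * (K + 1)\<^sup>2)"

definition isolation_const :: "real \<Rightarrow> real"
  where "isolation_const K = 2000 / (height_const K)\<^sup>2"

text \<open>An atom is good when the others look like a constant of moderate size from its neighbourhood. The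
  bound \<open>1 / 4\<close> makes the scale \<open>c n\<close> small against the size of the disk.\<close>

definition good_atom :: "real \<Rightarrow> (nat \<Rightarrow> real) \<Rightarrow> (nat \<Rightarrow> complex) \<Rightarrow> nat \<Rightarrow> bool"
  where "good_atom K c \<zeta> n \<longleftrightarrow> c n \<le> 1 / 4 \<and>
    isolation_const K * interaction c \<zeta> n \<le> 1 \<and>
    norm (herglotz_sum (c(n := 0)) \<zeta> (base_point c \<zeta> n)) \<le> K"

lemma height_const_bounds:
  assumes "0 \<le> K"
  shows "0 < height_const K" "height_const K \<le> 1 / 8"
proof -
  have "1 \<le> (K + 1)\<^sup>2"
    using assms by (simp add: one_le_power)
  then have "0 < (K + 1)\<^sup>2" "1 / (K + 1)\<^sup>2 \<le> 1"
    by (simp_all only: divide_le_eq_1_pos)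
  then show "0 < height_const K" "height_const K \<le> 1 / 8"
    unfolding height_const_def by simp_all
qed

lemma isolation_const_ge:
  assumes "0 \<le> K"
  shows "192 * (1 + 6 / height_const K) / height_const K \<le> isolation_const K" (is ?A)
    and "1 \<le> isolation_const K" (is ?B) and "8 \<le> isolation_const K" (is ?C)
    and "605 / height_const K < isolation_const K" (is ?D)
proof -
  define h where "h = height_const K"
  have h: "0 < h" "h \<le> 1 / 8"
    using height_const_bounds[OF assms] by (simp_all add: h_def)
  have h2: "h\<^sup>2 \<le> 1"
    using h by (simp add: power_le_one)
  show ?A ?D
    using h unfolding isolation_const_def h_def[symmetric]
    by (auto simp: field_simps power2_eq_square)
  show ?B ?C
    using h h2 unfolding isolation_const_def h_def[symmetric] by (simp_all add: field_simps)
qed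

context circle_weights
begin

text \<open>Near a good atom the zeros of the Cauchy transform solve \<open>\<delta> / (z - \<zeta> n) = R z\<close>, where
  \<open>\<delta> = c n\<close> and \<open>R\<close> is the Cauchy transform of the other atoms. So they are the fixed points of
  \<open>z \<mapsto> \<zeta> n + \<delta> / R z\<close>. This map is almost constant, with value \<open>p = \<zeta> n + \<delta> / R z0\<close>, because
  \<open>R\<close> hardly oscillates at scale \<open>\<delta>\<close>; hence it maps a small disk around \<open>p\<close> into itself and Brouwer's
  theorem applies. That \<open>p\<close> lies inside the unit disk, at height comparable to \<open>\<delta>\<close>, comes from the
  sign of the real part of \<open>q = z0 * R z0\<close>: the Poisson integral of the other atoms is small, so
  \<open>Re q\<close> is close to \<open>- (1 - \<delta>) / 2\<close>.\<close>

proposition good_atom_imp_zero: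
  assumes total: "suminf c = 1" and cn: "0 < c n" and K: "0 \<le> K"
    and good: "good_atom K c \<zeta> n"
  obtains z where "norm z < 1" "cauchy_sum c \<zeta> z = 0"
    "height_const K * c n \<le> 1 - norm z" "norm (z - \<zeta> n) \<le> 5 * c n"
    "norm (z - base_point c \<zeta> n) \<le> 6 * c n"
proof -
  interpret rest: circle_weights "c(n := 0)" \<zeta>
    by (rule circle_weights_remove)
  define \<delta> where "\<delta> = c n"
  define r where "r = 1 - \<delta>"
  define z0 where "z0 = complex_of_real r * \<zeta> n"
  define h where "h = height_const K"
  define A where "A = isolation_const K"
  define R where "R = cauchy_sum (c(n := 0)) \<zeta>"
  define S where "S = (\<Sum>m. (c(n := 0)) m / (norm (\<zeta> m - z0))\<^sup>2)"
  define q where "q = z0 * R z0"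
  have bp: "base_point c \<zeta> n = z0"
    by (simp add: base_point_def z0_def r_def \<delta>_def)
  have \<delta>: "0 < \<delta>" "\<delta> \<le> 1 / 4"
    using cn good by (auto simp: \<delta>_def good_atom_def)
  have r: "3 / 4 \<le> r" "r < 1"
    using \<delta> by (auto simp: r_def)
  have norm_z0: "norm z0 = r"
    using r by (simp add: z0_def norm_mult)
  then have z0: "norm z0 < 1" "z0 \<noteq> 0"
    using r by auto
  have h: "0 < h" "h \<le> 1 / 8" "h * (8 * (K + 1)\<^sup>2) = 1"
    using height_const_bounds[OF K] K by (auto simp: h_def height_const_def)
  have A: "192 * (1 + 6 / h) / h \<le> A" "8 \<le> A"
    using isolation_const_ge[OF K] by (simp_all add: A_def h_def)
  have sumS: "(\<lambda>m. (c(n := 0)) m / (norm (\<zeta> m - z0))\<^sup>2) sums S"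
    unfolding S_def using rest.summable_weighted_inverse_square[OF z0(1), of 1]
    by (intro summable_sums) simp
  have "interaction c \<zeta> n = \<delta> * S"
    using sums_unique[OF sums_mult[OF sumS, of \<delta>]] by (simp add: interaction_def bp \<delta>_def)
  then have AS: "A * (\<delta> * S) \<le> 1"
    using good by (simp add: good_atom_def A_def)
  then have \<delta>S: "\<delta> * S \<le> 1 / A"
    using A by (simp add: field_simps)

  \<comment> \<open>Herglotz and Cauchy transform of the rest at the base point: \<open>Re q\<close> lies in \<open>[-1/2, -1/4]\<close>.\<close>
  have W: "herglotz_sum (c(n := 0)) \<zeta> z0 = complex_of_real r + 2 * q"
    using rest.herglotz_eq_cauchy[OF z0(1)] suminf_remove[of n] total
    by (simp add: R_def q_def r_def \<delta>_def mult.assoc)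
  have *: "(\<lambda>m. (1 - r\<^sup>2) * ((c(n := 0)) m / (norm (\<zeta> m - z0))\<^sup>2)) sums
      Re (herglotz_sum (c(n := 0)) \<zeta> z0)"
    using rest.Re_herglotz_sums[OF z0(1)] by (simp add: norm_z0)
  have ReW: "r + 2 * Re q = (1 - r\<^sup>2) * S"
    using sums_unique2[OF * sums_mult[OF sumS, of "1 - r\<^sup>2"]] by (simp add: W)
  have S0: "0 \<le> S"
    by (rule sums_le[OF _ sums_zero sumS]) (simp add: weight_nonneg)
  have r2: "1 - r\<^sup>2 = \<delta> * (2 - \<delta>)"
    by (simp add: r_def power2_eq_square algebra_simps)
  have "(1 - r\<^sup>2) * S = (\<delta> * S) * (2 - \<delta>)"
    by (simp add: r2)
  also have "\<dots> \<le> (1 / A) * 2"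
    using \<delta>S \<delta> A S0 by (intro mult_mono) auto
  also have "\<dots> \<le> 1 / 4"
    using A by (simp add: field_simps)
  finally have "(1 - r\<^sup>2) * S \<le> 1 / 4" .
  moreover have "0 \<le> (1 - r\<^sup>2) * S"
    using \<delta> S0 by (simp add: r2)
  ultimately have Req: "Re q \<le> - 1 / 4" "- 1 / 2 \<le> Re q"
    using ReW r by linarith+
  have "2 * norm q = norm (herglotz_sum (c(n := 0)) \<zeta> z0 - complex_of_real r)"
    by (simp add: W norm_mult)
  also have "\<dots> \<le> K + 1"
    using norm_triangle_ineq4[of "herglotz_sum (c(n := 0)) \<zeta> z0" "complex_of_real r"] good r
    by (simp add: good_atom_def bp)
  finally have q_le: "norm q \<le> (K + 1) / 2"
    by simp
  have q_ge: "1 / 4 \<le> norm q"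
    using abs_Re_le_cmod[of q] Req by linarith
  then have q_nz: "q \<noteq> 0"
    by auto
  have "norm q = r * norm (R z0)"
    by (simp add: q_def norm_mult norm_z0)
  also have "\<dots> \<le> norm (R z0)"
    using r by (intro mult_left_le_one_le) auto
  finally have R0: "1 / 4 \<le> norm (R z0)"
    using q_ge by linarith

  \<comment> \<open>Since \<open>p = \<zeta> n * (1 + \<delta> * r / q)\<close>, the height of \<open>p\<close> is governed by \<open>Re q / \<bar>q\<bar>\<^sup>2\<close>.\<close>
  define p where "p = \<zeta> n + complex_of_real \<delta> / R z0"
  have "p = \<zeta> n * (1 + complex_of_real (\<delta> * r) / q)"
  proof -
    have "complex_of_real \<delta> / R z0 = complex_of_real \<delta> * z0 / q"
      using z0 by (simp add: q_def)
    then show ?thesis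
      by (simp add: p_def z0_def algebra_simps)
  qed
  also have "1 + complex_of_real (\<delta> * r) / q = (q + complex_of_real (\<delta> * r)) / q"
    using q_nz by (simp add: add_divide_distrib)
  finally have p_sq: "(norm p)\<^sup>2 = (norm (q + complex_of_real (\<delta> * r)))\<^sup>2 / (norm q)\<^sup>2"
    by (simp add: norm_mult norm_divide power_divide)
  have "(norm (q + complex_of_real (\<delta> * r)))\<^sup>2 = (norm q)\<^sup>2 + \<delta> * r * (2 * Re q + \<delta> * r)"
    unfolding cmod_power2 by (simp add: power2_eq_square algebra_simps)
  also have "\<dots> \<le> (norm q)\<^sup>2 - \<delta> * (3 / 16)"
  proof -
    have "\<delta> * r \<le> 1 / 4"
      using \<delta> r mult_mono[of \<delta> "1/4" r 1] by simp
    then have "1 / 4 \<le> - (2 * Re q + \<delta> * r)"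
      using Req by linarith
    moreover have "\<delta> * (3 / 4) \<le> \<delta> * r"
      using \<delta> r by (intro mult_left_mono) auto
    ultimately have "(\<delta> * (3 / 4)) * (1 / 4) \<le> (\<delta> * r) * - (2 * Re q + \<delta> * r)"
      using \<delta> r by (intro mult_mono) auto
    then show ?thesis
      by (simp add: algebra_simps)
  qed
  finally have "(norm p)\<^sup>2 \<le> ((norm q)\<^sup>2 - \<delta> * (3 / 16)) / (norm q)\<^sup>2"
    unfolding p_sq by (intro divide_right_mono) auto
  also have "\<dots> = 1 - \<delta> * (3 / 16) / (norm q)\<^sup>2"
    using q_nz by (simp add: diff_divide_distrib)
  also have "\<dots> \<le> 1 - 4 * h * \<delta>"
  proof -
    have "(norm q)\<^sup>2 \<le> ((K + 1) / 2)\<^sup>2"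
      using q_le by (intro power_mono) auto
    then have "h * (norm q)\<^sup>2 \<le> h * ((K + 1) / 2)\<^sup>2"
      using h by (intro mult_left_mono) auto
    also have "\<dots> = 1 / 32"
      using h(3) by (simp add: power_divide)
    finally have "4 * (h * (norm q)\<^sup>2) \<le> 3 / 16"
      by simp
    then have "\<delta> * (4 * (h * (norm q)\<^sup>2)) \<le> \<delta> * (3 / 16)"
      using \<delta> by (intro mult_left_mono) auto
    moreover have "0 < (norm q)\<^sup>2"
      using q_ge by (intro zero_less_power) linarith
    ultimately have "4 * h * \<delta> \<le> \<delta> * (3 / 16) / (norm q)\<^sup>2"
      by (subst pos_le_divide_eq) (simp_all add: mult_ac)
    then show ?thesis
      by simp
  qed
  finally have "4 * h * \<delta> \<le> 1 - (norm p)\<^sup>2"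
    by simp
  also have "\<dots> \<le> 2 * (1 - norm p)"
    using zero_le_power2[of "1 - norm p"] by (simp add: power2_eq_square algebra_simps)
  finally have p_le: "2 * (h * \<delta>) \<le> 1 - norm p"
    by simp
  have p_\<zeta>: "norm (p - \<zeta> n) \<le> 4 * \<delta>"
  proof -
    have "norm (p - \<zeta> n) = \<delta> / norm (R z0)"
      using \<delta> by (simp add: p_def norm_divide)
    also have "\<dots> \<le> \<delta> / (1 / 4)"
      using R0 \<delta> by (intro divide_left_mono) (auto intro: mult_pos_pos)
    finally show ?thesis by simp
  qed

  \<comment> \<open>As \<open>p\<close> has height at least \<open>2 * h * \<delta>\<close>, half of it is left on the disk where the fixed point is sought.\<close>
  have ball: "h * \<delta> \<le> 1 - norm z" "norm z < 1" "norm (z - \<zeta> n) \<le> 5 * \<delta>" "norm (z - z0) \<le> 6 * \<delta>"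
    if "z \<in> cball p (h * \<delta>)" for z
  proof -
    have zp: "norm (z - p) \<le> h * \<delta>"
      using that by (simp add: dist_norm norm_minus_commute)
    have hd: "0 < h * \<delta>" "h * \<delta> \<le> \<delta>"
      using h \<delta> by (auto intro: mult_left_le_one_le)
    show "h * \<delta> \<le> 1 - norm z"
      using norm_triangle_ineq[of p "z - p"] zp p_le by simp
    then show "norm z < 1"
      using hd by linarith
    show *: "norm (z - \<zeta> n) \<le> 5 * \<delta>"
      using norm_triangle_ineq[of "z - p" "p - \<zeta> n"] zp p_\<zeta> hd by simp
    have "\<zeta> n - z0 = complex_of_real \<delta> * \<zeta> n"
      by (simp add: z0_def r_def algebra_simps)
    then have "norm (\<zeta> n - z0) = \<delta>"
      using \<delta> by (simp add: norm_mult)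
    then show "norm (z - z0) \<le> 6 * \<delta>"
      using norm_triangle_ineq[of "z - \<zeta> n" "\<zeta> n - z0"] * by simp
  qed

  have osc: "norm (R z - R z0) \<le> h / 32" if z: "z \<in> cball p (h * \<delta>)" for z
  proof -
    have "norm (\<zeta> m - z0) \<le> (1 + 6 / h) * norm (\<zeta> m - z)" for m
    proof -
      have "h * \<delta> \<le> norm (\<zeta> m - z)"
        using ball(1)[OF z] dist_atom_ge[of z m] by linarith
      then have "6 * \<delta> \<le> (6 / h) * norm (\<zeta> m - z)"
        using h by (simp add: field_simps)
      moreover have "norm (\<zeta> m - z0) \<le> norm (\<zeta> m - z) + norm (z - z0)"
        using norm_triangle_ineq[of "\<zeta> m - z" "z - z0"] by simp
      ultimately show ?thesis
        using ball(4)[OF z] by (simp add: algebra_simps)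
    qed
    then have "norm (R z - R z0) \<le> (1 + 6 / h) * norm (z - z0) * S"
      unfolding R_def S_def by (intro rest.cauchy_sum_oscillation ball z z0)
    also have "\<dots> \<le> (1 + 6 / h) * (6 * \<delta>) * S"
      using ball(4)[OF z] S0 h by (intro mult_right_mono mult_left_mono) auto
    also have "\<dots> = 6 * (1 + 6 / h) * (\<delta> * S)"
      by simp
    also have "\<dots> \<le> 6 * (1 + 6 / h) * (1 / A)"
      using \<delta>S h by (intro mult_left_mono) auto
    also have "\<dots> \<le> h / 32"
      using A h by (simp add: field_simps)
    finally show ?thesis .
  qed
  have R_ge: "1 / 8 \<le> norm (R z)" if z: "z \<in> cball p (h * \<delta>)" for z
    using osc[OF z] R0 h norm_triangle_ineq2[of "R z0" "R z"] by (simp add: norm_minus_commute)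
  obtain z where z: "z \<in> cball p (h * \<delta>)" and fixpoint: "\<zeta> n + complex_of_real \<delta> / R z = z"
  proof (rule brouwer_ball[of "h * \<delta>" p "\<lambda>z. \<zeta> n + complex_of_real \<delta> / R z"])
    show "0 < h * \<delta>"
      using h \<delta> by simp
    have "continuous_on (cball p (h * \<delta>)) R"
      unfolding R_def
      by (rule holomorphic_on_imp_continuous_on[OF holomorphic_on_subset[OF rest.holomorphic_cauchy_sum]])
        (use ball in auto)
    then show "continuous_on (cball p (h * \<delta>)) (\<lambda>z. \<zeta> n + complex_of_real \<delta> / R z)"
      using R_ge by (intro continuous_intros) force+
    show "(\<lambda>z. \<zeta> n + complex_of_real \<delta> / R z) \<in> cball p (h * \<delta>) \<rightarrow> cball p (h * \<delta>)"
    proof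
      fix z assume z: "z \<in> cball p (h * \<delta>)"
      have nz: "0 < norm (R z)" "0 < norm (R z0)"
        using R_ge[OF z] R0 by linarith+
      have "p - (\<zeta> n + complex_of_real \<delta> / R z) = complex_of_real \<delta> * (R z - R z0) / (R z * R z0)"
        using nz by (simp add: p_def field_simps)
      then have "dist p (\<zeta> n + complex_of_real \<delta> / R z)
          = \<delta> * norm (R z - R z0) / (norm (R z) * norm (R z0))"
        using \<delta> by (simp add: dist_norm norm_mult norm_divide)
      also have "\<dots> \<le> \<delta> * (h / 32) / ((1 / 8) * (1 / 4))"
        using osc[OF z] R_ge[OF z] R0 \<delta> h by (intro frac_le mult_mono mult_left_mono) auto
      finally show "\<zeta> n + complex_of_real \<delta> / R z \<in> cball p (h * \<delta>)"
        by (simp add: mult.commute)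
    qed
  qed
  have "R z \<noteq> 0"
    using R_ge[OF z] by auto
  moreover have "\<zeta> n - z = - (complex_of_real \<delta> / R z)"
    using fixpoint by (metis add_diff_cancel_left' minus_diff_eq)
  ultimately have "cauchy_sum c \<zeta> z = 0"
    using cauchy_sum_split[OF ball(2)[OF z], of n] \<delta> by (simp add: R_def \<delta>_def)
  with ball[OF z] show ?thesis
    by (intro that[of z]) (simp_all add: h_def \<delta>_def bp)
qed

text \<open>A common zero would have height comparable to each of the two masses, so the masses would be comparable, and
  its distance from either atom would be at most of this order. The heavier atom alone, being that close,
  would violate the isolation of the lighter one.\<close>

lemma zeros_of_good_atoms_distinct:
  assumes K: "0 \<le> K" and good: "good_atom K c \<zeta> n"
    and nm: "m \<noteq> n" and pos: "0 < c n" and le: "c n \<le> c m"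
    and zn: "norm (z - \<zeta> n) \<le> 5 * c n" "norm (z - base_point c \<zeta> n) \<le> 6 * c n"
    and zm: "norm (z - \<zeta> m) \<le> 5 * c m" "height_const K * c m \<le> 1 - norm z"
  shows False
proof -
  interpret rest: circle_weights "c(n := 0)" \<zeta>
    by (rule circle_weights_remove)
  define h where "h = height_const K"
  define z0 where "z0 = base_point c \<zeta> n"
  have h: "0 < h"
    using height_const_bounds[OF K] by (simp add: h_def)
  have z0: "norm z0 < 1"
  proof -
    have "norm z0 = \<bar>1 - c n\<bar>"
      unfolding z0_def base_point_def norm_mult norm_of_real norm_atom by (rule mult_1_right)
    then show ?thesis
      using pos good by (simp add: good_atom_def)
  qed
  have hm: "h * c m \<le> 5 * c n"
    using zm(2) dist_atom_ge[of z n] zn(1) by (simp add: h_def norm_minus_commute)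
  have "norm (\<zeta> m - z0) \<le> norm (\<zeta> m - z) + norm (z - z0)"
    using norm_triangle_ineq[of "\<zeta> m - z" "z - z0"] by simp
  then have "norm (\<zeta> m - z0) \<le> 11 * c m"
    using zm(1) zn(2) le by (simp add: z0_def norm_minus_commute)
  then have d2: "(norm (\<zeta> m - z0))\<^sup>2 \<le> 121 * (c m)\<^sup>2"
    using power_mono[of "norm (\<zeta> m - z0)" "11 * c m" 2] by (simp add: power_mult_distrib)
  have d0: "0 < (norm (\<zeta> m - z0))\<^sup>2"
    using atom_neq[OF z0, of m] by simp
  have cm: "0 < c m"
    using pos le by linarith
  have "h / 605 \<le> c n * c m / (121 * (c m)\<^sup>2)"
    using hm cm by (simp add: field_simps power2_eq_square)
  also have "\<dots> \<le> c n * c m / (norm (\<zeta> m - z0))\<^sup>2"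
    using d0 d2 pos cm by (intro divide_left_mono) (auto intro!: mult_pos_pos)
  also have "\<dots> = (\<Sum>k\<in>{m}. c n * (c(n := 0)) k / (norm (\<zeta> k - z0))\<^sup>2)"
    using nm by simp
  also have "\<dots> \<le> interaction c \<zeta> n"
    unfolding interaction_def z0_def[symmetric] using pos
    by (intro sum_le_suminf rest.summable_weighted_inverse_square z0)
      (auto simp: weight_nonneg)
  finally have "605 / h * (h / 605) < isolation_const K * interaction c \<zeta> n"
    using isolation_const_ge[OF K] h
    by (intro mult_less_le_imp_less) (auto simp: h_def)
  then show False
    using good h by (simp add: good_atom_def)
qed

end

section \<open>Divergence along the zeros from divergence along the good atoms\<close>

text \<open>The zeros paired with indices below their order form a countably infinite set; enumerating it and
  forgetting the index lists every zero with its multiplicity.\<close>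

lemma zero_sequence_exists:
  assumes hol: "f holomorphic_on ball 0 1" and nz: "w \<in> ball 0 1" "f w \<noteq> 0"
    and inf: "infinite {z \<in> ball 0 1. f z = 0}"
  shows "\<exists>\<Lambda>. zero_sequence f \<Lambda>"
proof -
  define Z where "Z = {z \<in> ball 0 1. f z = 0}"
  have zorder_pos: "0 < zorder f z" if "z \<in> Z" for z
  proof -
    have "\<exists>\<^sub>F z in at z. f z \<noteq> 0"
    proof (rule ccontr)
      assume "\<not> ?thesis"
      then have ev: "\<forall>\<^sub>F x in at z. f x = 0"
        by (simp add: not_frequently)
      then have "f w = 0"
      proof -
        obtain S where S: "open S" "z \<in> S" "\<And>x. x \<in> S \<Longrightarrow> x \<noteq> z \<Longrightarrow> f x = 0"
          using ev by (auto simp: eventually_at_topological)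
        have "f x = 0" if "x \<in> S" for x
          using S that \<open>z \<in> Z\<close> by (cases "x = z") (auto simp: Z_def)
        then show ?thesis
          using analytic_continuation_open[of "S \<inter> ball 0 1" "ball 0 1" f "\<lambda>_. 0" w] S nz hol
            \<open>z \<in> Z\<close> by (force simp: Z_def)
      qed
      then show False
        using nz by simp
    qed
    then show ?thesis
      using zorder_pos_iff[OF hol open_ball, of z] that by (simp add: Z_def)
  qed
  have "\<not> f constant_on ball 0 1"
    using inf nz by (auto simp: constant_on_def dest!: infinite_imp_nonempty)
  moreover have "fsigma (ball 0 1 :: complex set)"
    using open_Union_compact_subsets[OF open_ball] unfolding fsigma_Union_compact
    by (metis image_subsetI mem_Collect_eq)
  ultimately have "countable Z"
    unfolding Z_def by (intro holomorphic_countable_zeros hol) auto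
  define S where "S = (SIGMA z:Z. {..<nat (zorder f z)})"
  have "(z, 0) \<in> S" if "z \<in> Z" for z
    using that zorder_pos[OF that] by (simp add: S_def)
  then have "Z \<subseteq> fst ` S"
    by (metis fst_conv image_eqI subsetI)
  then have "Z = fst ` S"
    by (auto simp: S_def)
  then have "infinite S"
    using inf unfolding Z_def[symmetric] by auto
  moreover have "countable S"
    unfolding S_def using \<open>countable Z\<close> by auto
  ultimately obtain b where b: "bij_betw b (UNIV :: nat set) S"
    using countable_infiniteE' by blast
  have "zero_sequence f (fst \<circ> b)"
    unfolding zero_sequence_def
  proof (intro conjI ballI impI)
    show "range (fst \<circ> b) = {z \<in> ball 0 1. f z = 0}"
      using bij_betw_imp_surj_on[OF b] \<open>Z = fst ` S\<close>
      unfolding image_comp[symmetric] Z_def by simp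
    fix z :: complex
    assume "z \<in> ball 0 1" "f z = 0"
    then have z: "z \<in> Z" by (simp add: Z_def)
    have "bij_betw b {k. (fst \<circ> b) k = z} ({z} \<times> {..<nat (zorder f z)})"
    proof (rule bij_betw_subset[OF b])
      have "{z} \<times> {..<nat (zorder f z)} = {x \<in> S. fst x = z}"
        using z by (auto simp: S_def)
      also have "\<dots> = b ` {k. fst (b k) = z}"
        using bij_betw_imp_surj_on[OF b] by auto
      finally show "b ` {k. (fst \<circ> b) k = z} = {z} \<times> {..<nat (zorder f z)}"
        by simp
    qed simp
    then have "card {k. (fst \<circ> b) k = z} = card ({z} \<times> {..<nat (zorder f z)})"
      by (rule bij_betw_same_card)
    then show "int (card {k. (fst \<circ> b) k = z}) = zorder f z"
      using zorder_pos[OF z] by simp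
  qed
  then show ?thesis
    by blast
qed

lemma powr_ge_of_comparable:
  fixes s a b x y :: real
  assumes "0 < a" "0 < b" "0 < y" "a * y \<le> x" "x \<le> b * y"
  shows "min (a powr s) (b powr s) * y powr s \<le> x powr s"
proof (cases "0 \<le> s")
  case True
  have "a powr s * y powr s = (a * y) powr s"
    using assms by (simp add: powr_mult)
  also have "\<dots> \<le> x powr s"
    using assms True by (intro powr_mono2) auto
  finally show ?thesis
    by (meson min.cobounded1 mult_right_mono order_trans powr_ge_zero)
next
  case False
  have "0 < a * y"
    using assms by simp
  then have "0 < x"
    using assms by linarith
  have "b powr s * y powr s = (b * y) powr s"
    using assms by (simp add: powr_mult)
  also have "\<dots> \<le> x powr s"
    using assms False \<open>0 < x\<close> by (intro powr_mono2') auto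
  finally show ?thesis
    by (meson min.cobounded2 mult_right_mono order_trans powr_ge_zero)
qed

text \<open>Different indices in \<open>G\<close> use up different entries of \<open>\<Lambda>\<close>, since they belong to different zeros.\<close>

lemma zero_sequence_sum_infinite:
  fixes l :: "nat \<Rightarrow> complex" and c :: "nat \<Rightarrow> real" and s :: real
  assumes seq: "zero_sequence f \<Lambda>"
    and zero: "\<And>n. n \<in> G \<Longrightarrow> l n \<in> ball 0 1 \<and> f (l n) = 0"
    and inj: "inj_on l G" and h: "0 < h" and c: "\<And>n. 0 < c n"
    and lower: "\<And>n. n \<in> G \<Longrightarrow> h * c n \<le> 1 - norm (l n)"
    and upper: "\<And>n. n \<in> G \<Longrightarrow> 1 - norm (l n) \<le> 5 * c n"
    and div: "(\<Sum>n. ennreal (c n powr s) * indicator G n) = \<infinity>"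
  shows "(\<Sum>k. ennreal ((1 - norm (\<Lambda> k)) powr s)) = \<infinity>"
proof -
  define D where "D = min (h powr s) (5 powr s)"
  have D: "0 < D"
    using h by (simp add: D_def)
  have "\<forall>n\<in>G. \<exists>k. \<Lambda> k = l n"
    using seq zero unfolding zero_sequence_def by (metis (mono_tags, lifting) mem_Collect_eq rangeE)
  then obtain k where k: "\<And>n. n \<in> G \<Longrightarrow> \<Lambda> (k n) = l n"
    by metis
  have injk: "inj_on k G"
    using inj k by (metis inj_on_def)
  have "ennreal D * \<infinity> = ennreal D * (\<Sum>n. ennreal (c n powr s) * indicator G n)"
    by (simp only: div)
  also have "\<dots> = ennreal D * (\<integral>\<^sup>+n. ennreal (c n powr s) * indicator G n \<partial>count_space UNIV)"
    by (simp add: nn_integral_count_space_nat)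
  also have "\<dots> = (\<integral>\<^sup>+n. ennreal D * (ennreal (c n powr s) * indicator G n) \<partial>count_space UNIV)"
    by (rule nn_integral_cmult[symmetric]) simp
  also have "\<dots> = (\<integral>\<^sup>+n. ennreal (D * c n powr s) * indicator G n \<partial>count_space UNIV)"
    using D by (simp add: ennreal_mult mult.assoc)
  also have "\<dots> = (\<integral>\<^sup>+n. ennreal (D * c n powr s) \<partial>count_space G)"
    by (rule nn_integral_count_space_indicator[symmetric]) simp
  also have "\<dots> \<le> (\<integral>\<^sup>+n. ennreal ((1 - norm (\<Lambda> (k n))) powr s) \<partial>count_space G)"
    unfolding D_def using k h c lower upper
    by (intro nn_integral_mono ennreal_leI powr_ge_of_comparable) auto
  also have "\<dots> = (\<integral>\<^sup>+j. ennreal ((1 - norm (\<Lambda> j)) powr s) \<partial>count_space (k ` G))"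
    by (rule nn_integral_bij_count_space) (rule inj_on_imp_bij_betw[OF injk])
  also have "\<dots> = (\<integral>\<^sup>+j. ennreal ((1 - norm (\<Lambda> j)) powr s) * indicator (k ` G) j \<partial>count_space UNIV)"
    by (rule nn_integral_count_space_indicator) simp
  also have "\<dots> \<le> (\<integral>\<^sup>+j. ennreal ((1 - norm (\<Lambda> j)) powr s) \<partial>count_space UNIV)"
    by (intro nn_integral_mono) (auto simp: indicator_def)
  also have "\<dots> = (\<Sum>j. ennreal ((1 - norm (\<Lambda> j)) powr s))"
    by (rule nn_integral_count_space_nat)
  finally show ?thesis
    using D by (simp add: ennreal_mult_top top_unique)
qed

context circle_weights
begin

text \<open>Radially above an atom the Poisson kernel blows up. This shows that the inner function does not vanish
  identically.\<close>

lemma Re_herglotz_gt_1: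
  assumes total: "suminf c = 1" and pos: "0 < c n"
  obtains z where "norm z < 1" "1 < Re (herglotz_sum c \<zeta> z)"
proof -
  define r where "r = 1 - c n / 2"
  define z where "z = complex_of_real r * \<zeta> n"
  have c1: "c n \<le> 1"
    using sum_le_suminf[OF summable_weights, of "{n}"] weight_nonneg total by simp
  have norm_z: "norm z = r"
    using c1 by (simp add: z_def norm_mult r_def del: of_real_diff)
  then have z: "norm z < 1"
    using pos by (simp add: r_def)
  have "\<zeta> n - z = complex_of_real (c n / 2) * \<zeta> n"
    by (simp add: z_def r_def algebra_simps)
  then have "norm (\<zeta> n - z) = \<bar>c n / 2\<bar>"
    by (simp only: norm_mult norm_of_real norm_atom mult_1_right)
  then have d: "norm (\<zeta> n - z) = c n / 2"
    using pos by simp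
  have "1 < 4 - c n"
    using c1 by linarith
  also have "\<dots> = (1 - r\<^sup>2) * c n / (c n / 2)\<^sup>2"
    using pos by (simp add: r_def power2_eq_square field_simps)
  also have "\<dots> = (\<Sum>m\<in>{n}. (1 - (norm z)\<^sup>2) * c m / (norm (\<zeta> m - z))\<^sup>2)"
    by (simp add: norm_z d)
  also have "\<dots> \<le> (\<Sum>m. (1 - (norm z)\<^sup>2) * c m / (norm (\<zeta> m - z))\<^sup>2)"
    using z by (intro sum_le_suminf summable_weighted_inverse_square)
      (auto intro!: divide_nonneg_nonneg mult_nonneg_nonneg simp: weight_nonneg power_le_one)
  also have "\<dots> = Re (herglotz_sum c \<zeta> z)"
    by (rule sums_unique[OF Re_herglotz_sums[OF z], symmetric])
  finally show ?thesis
    using that z by blast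
qed

text \<open>The deterministic half of the argument: each good atom contributes its own zero, at a height
  comparable to its mass.\<close>

proposition zeros_diverge_of_good_atoms:
  assumes total: "suminf c = 1" and pos: "\<And>n. 0 < c n" and K: "0 \<le> K"
    and div: "(\<Sum>n. ennreal (c n powr s) * indicator {n. good_atom K c \<zeta> n} n) = \<infinity>"
  defines "f \<equiv> inner_of (atomic_measure c \<zeta>)"
  shows "(\<exists>\<Lambda>. zero_sequence f \<Lambda>) \<and>
    (\<forall>\<Lambda>. zero_sequence f \<Lambda> \<longrightarrow> (\<Sum>k. ennreal ((1 - norm (\<Lambda> k)) powr s)) = \<infinity>)"
proof -
  let ?H = "herglotz_sum c \<zeta>"
  define G where "G = {n. good_atom K c \<zeta> n}"
  have f: "f z = (?H z - 1) / (?H z + 1)" if "norm z < 1" for z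
    using herglotz_atomic_measure[OF that] by (simp add: f_def inner_of_def)
  have denom: "?H z + 1 \<noteq> 0" if "norm z < 1" for z
    using Re_herglotz_nonneg[OF that] by (auto simp: complex_eq_iff)
  have hol: "f holomorphic_on ball 0 1"
  proof (rule holomorphic_transform)
    show "(\<lambda>z. (?H z - 1) / (?H z + 1)) holomorphic_on ball 0 1"
      using denom by (intro holomorphic_intros holomorphic_herglotz_sum) auto
  qed (simp add: f)
  obtain w where w: "norm w < 1" "1 < Re (?H w)"
    using Re_herglotz_gt_1[OF total pos] by blast
  then have "?H w \<noteq> 1"
    by auto
  then have nz: "w \<in> ball 0 1" "f w \<noteq> 0"
    using w denom[of w] by (auto simp: f)
  have "\<forall>n\<in>G. \<exists>z. norm z < 1 \<and> cauchy_sum c \<zeta> z = 0 \<and>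
      height_const K * c n \<le> 1 - norm z \<and> norm (z - \<zeta> n) \<le> 5 * c n \<and>
      norm (z - base_point c \<zeta> n) \<le> 6 * c n"
    using good_atom_imp_zero[OF total pos K] unfolding G_def by blast
  then obtain l where l: "\<And>n. n \<in> G \<Longrightarrow> norm (l n) < 1"
    "\<And>n. n \<in> G \<Longrightarrow> cauchy_sum c \<zeta> (l n) = 0"
    "\<And>n. n \<in> G \<Longrightarrow> height_const K * c n \<le> 1 - norm (l n)"
    "\<And>n. n \<in> G \<Longrightarrow> norm (l n - \<zeta> n) \<le> 5 * c n"
    "\<And>n. n \<in> G \<Longrightarrow> norm (l n - base_point c \<zeta> n) \<le> 6 * c n"
    by metis
  have zero: "l n \<in> ball 0 1 \<and> f (l n) = 0" if "n \<in> G" for n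
    using l(1,2)[OF that] total by (simp add: f herglotz_eq_cauchy)
  have inj: "inj_on l G"
  proof (rule inj_onI, rule ccontr)
    fix m n assume mn: "m \<in> G" "n \<in> G" "l m = l n" "m \<noteq> n"
    then have good: "good_atom K c \<zeta> m" "good_atom K c \<zeta> n"
      by (auto simp: G_def)
    show False
    proof (cases "c n \<le> c m")
      case True
      show False
        by (rule zeros_of_good_atoms_distinct[OF K good(2) mn(4) pos True, of "l n"])
          (use mn l(3-5)[of m] l(3-5)[of n] in auto)
    next
      case False
      show False
        by (rule zeros_of_good_atoms_distinct[OF K good(1) mn(4)[symmetric] pos, of "l n"])
          (use False mn l(3-5)[of m] l(3-5)[of n] in auto)
    qed
  qed
  have "infinite G"
  proof
    assume "finite G"
    then have "(\<Sum>n. ennreal (c n powr s) * indicator G n) = (\<Sum>n\<in>G. ennreal (c n powr s) * indicator G n)"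
      by (intro suminf_finite) (auto simp: indicator_def)
    then show False
      using div \<open>finite G\<close> by (simp add: G_def)
  qed
  moreover have "l ` G \<subseteq> {z \<in> ball 0 1. f z = 0}"
    using zero by blast
  ultimately have "infinite {z \<in> ball 0 1. f z = 0}"
    using inj finite_imageD finite_subset by blast
  with hol nz have "\<exists>\<Lambda>. zero_sequence f \<Lambda>"
    by (rule zero_sequence_exists)
  moreover have "(\<Sum>k. ennreal ((1 - norm (\<Lambda> k)) powr s)) = \<infinity>" if "zero_sequence f \<Lambda>" for \<Lambda>
  proof (rule zero_sequence_sum_infinite[OF that zero inj])
    show "0 < height_const K"
      by (rule height_const_bounds[OF K])
    show "1 - norm (l n) \<le> 5 * c n" if "n \<in> G" for n
      using l(4)[OF that] dist_atom_ge[of "l n" n] by (simp add: norm_minus_commute)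
    show "(\<Sum>n. ennreal (c n powr s) * indicator G n) = \<infinity>"
      using div by (simp add: G_def)
  qed (use pos l in auto)
  ultimately show ?thesis
    by blast
qed

end

section \<open>Averages over the position of one atom\<close>

abbreviation uniform_angle :: "real measure"
  where "uniform_angle \<equiv> uniform_measure lborel {0..<2 * pi}"

lemma borel_measurable_cis [measurable]: "cis \<in> borel_measurable borel"
  by (intro borel_measurable_continuous_onI continuous_intros)

text \<open>The mean value property, read off from Cauchy's integral formula at the centre of the circle. It is
  stated for nonnegative real parts so that it can be used for the extended nonnegative integral.\<close>

lemma nn_integral_circle_mean:
  assumes hol: "f holomorphic_on ball 0 1" and r: "0 < r" "r < 1"
    and nonneg: "\<And>z. norm z < 1 \<Longrightarrow> 0 \<le> Re (f z)"
  shows "(\<integral>\<^sup>+x. ennreal (Re (f (complex_of_real r * cis x))) \<partial>uniform_angle) = ennreal (Re (f 0))"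
proof -
  define g where "g = (\<lambda>x. Re (f (complex_of_real r * cis x)))"
  have norm_lt: "norm (complex_of_real r * cis x) < 1" for x
    using r by (simp add: norm_mult)
  have cont: "continuous_on UNIV (\<lambda>x. f (complex_of_real r * cis x))"
    by (rule continuous_on_compose2[OF holomorphic_on_imp_continuous_on[OF hol]])
      (use norm_lt in \<open>auto intro!: continuous_intros simp: dist_norm\<close>)
  have g_nonneg: "0 \<le> g x" for x
    using nonneg[OF norm_lt] by (simp add: g_def)
  have [measurable]: "g \<in> borel_measurable borel"
    unfolding g_def by (intro borel_measurable_continuous_onI continuous_intros cont)
  have "((\<lambda>u. f u / (u - 0)) has_contour_integral (2 * of_real pi * \<i> * f 0)) (circlepath 0 r)"
    using r hol
    by (intro Cauchy_integral_circlepath holomorphic_on_imp_continuous_on)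
      (auto elim!: holomorphic_on_subset)
  then have "((\<lambda>t. f (complex_of_real r * cis t) / (complex_of_real r * cis t)
      * complex_of_real r * \<i> * cis t) has_integral (2 * of_real pi * \<i> * f 0)) {0..2 * pi}"
    by (simp add: circlepath_def has_contour_integral_part_circlepath_iff)
  also have "(\<lambda>t. f (complex_of_real r * cis t) / (complex_of_real r * cis t)
      * complex_of_real r * \<i> * cis t) = (\<lambda>t. \<i> * f (complex_of_real r * cis t))"
    using r by (auto simp: field_simps)
  finally have "((\<lambda>t. - \<i> * (\<i> * f (complex_of_real r * cis t))) has_integral
      - \<i> * (2 * of_real pi * \<i> * f 0)) {0..2 * pi}"
    by (rule has_integral_mult_right)
  also have "(\<lambda>t. - \<i> * (\<i> * f (complex_of_real r * cis t))) = (\<lambda>t. f (complex_of_real r * cis t))"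
    by (simp add: mult.assoc[symmetric])
  also have "- \<i> * (2 * of_real pi * \<i> * f 0) = complex_of_real (2 * pi) * f 0"
    by (simp add: complex_eq_iff)
  finally have "((\<lambda>t. f (complex_of_real r * cis t)) has_integral (complex_of_real (2 * pi) * f 0)) {0..2 * pi}" .
  then have "((Re \<circ> (\<lambda>t. f (complex_of_real r * cis t))) has_integral
      Re (complex_of_real (2 * pi) * f 0)) {0..2 * pi}"
    by (rule has_integral_linear[OF _ bounded_linear_Re])
  then have "(g has_integral (2 * pi * Re (f 0))) {0..2 * pi}"
    by (simp add: g_def o_def)
  then have "(g has_integral (2 * pi * Re (f 0))) {0..<2 * pi}"
    by (subst (asm) has_integral_spike_set_eq[where T = "{0..<2 * pi}"])
      (auto intro: negligible_subset[of "{2 * pi}"])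
  then have "((\<lambda>x. g x * indicator {0..<2 * pi} x) has_integral (2 * pi * Re (f 0))) UNIV"
    unfolding has_integral_restrict_UNIV[of "{0..<2 * pi}" g, symmetric]
    by (rule has_integral_eq[rotated]) (simp add: indicator_def)
  then have "(\<integral>\<^sup>+x. ennreal (g x * indicator {0..<2 * pi} x) \<partial>lborel) = ennreal (2 * pi * Re (f 0))"
    by (intro nn_integral_has_integral_lborel) (auto simp: g_nonneg)
  then have "(\<integral>\<^sup>+x. ennreal (g x) \<partial>uniform_angle) = ennreal (2 * pi * Re (f 0)) / ennreal (2 * pi)"
    by (simp add: nn_integral_uniform_measure ennreal_mult'' ennreal_indicator g_nonneg)
  also have "\<dots> = ennreal (Re (f 0))"
    using nonneg[of 0] by (simp add: divide_ennreal)
  finally show ?thesis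
    by (simp add: g_def)
qed

lemma nn_integral_poisson_kernel:
  assumes a: "norm a = 1" and r: "0 < r" "r < 1" and k: "0 \<le> k"
  shows "(\<integral>\<^sup>+x. ennreal (k / (norm (a - complex_of_real r * cis x))\<^sup>2) \<partial>uniform_angle)
    = ennreal (k / (1 - r\<^sup>2))"
proof -
  have r2: "r\<^sup>2 < 1"
    using r by (simp add: power_less_one_iff)
  define f where "f z = complex_of_real (k / (1 - r\<^sup>2)) * ((a + z) / (a - z))" for z
  have Re_f: "Re (f z) = k / (1 - r\<^sup>2) * ((1 - (norm z)\<^sup>2) / (norm (a - z))\<^sup>2)" for z
    unfolding f_def Re_herglotz_kernel[OF a, symmetric]
    by (simp only: times_complex.sel Re_complex_of_real Im_complex_of_real mult_zero_left diff_zero)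
  have "Re (f (complex_of_real r * cis x)) = k / (norm (a - complex_of_real r * cis x))\<^sup>2" for x
    using r r2 by (simp add: Re_f norm_mult)
  then have "(\<integral>\<^sup>+x. ennreal (k / (norm (a - complex_of_real r * cis x))\<^sup>2) \<partial>uniform_angle)
      = (\<integral>\<^sup>+x. ennreal (Re (f (complex_of_real r * cis x))) \<partial>uniform_angle)"
    by simp
  also have "\<dots> = ennreal (Re (f 0))"
  proof (rule nn_integral_circle_mean[OF _ r])
    show "f holomorphic_on ball 0 1"
      unfolding f_def using a by (intro holomorphic_intros) auto
    show "0 \<le> Re (f z)" if "norm z < 1" for z
      using r2 k that by (auto simp: Re_f power_le_one intro!: mult_nonneg_nonneg divide_nonneg_nonneg)
  qed
  also have "Re (f 0) = k / (1 - r\<^sup>2)"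
    using a by (simp add: Re_f)
  finally show ?thesis .
qed

text \<open>Both bounds are Poisson integrals. The first one is taken at the radius \<open>1 - \<delta>\<close> itself. For the second one the
  truncated kernel at radius \<open>1 - \<delta>\<close> is dominated by a multiple of the kernel at the smaller radius
  \<open>1 - sqrt \<delta>\<close>, whose integral is smaller. The first bound is summable in the weights, and the second one
  tends to \<open>0\<close> with \<open>\<delta>\<close>.\<close>

lemma nn_integral_truncated_interaction:
  assumes a: "norm a = 1" and \<delta>: "0 < \<delta>" "\<delta> \<le> 1 / 4" and w: "0 \<le> w" "w \<le> 1" and A: "1 \<le> A"
  shows "(\<integral>\<^sup>+x. ennreal (min 1 (A * (\<delta> * w / (norm (a - complex_of_real (1 - \<delta>) * cis x))\<^sup>2))) \<partial>uniform_angle)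
    \<le> ennreal (min (A * w) (4 * A * sqrt \<delta>))" (is "?I \<le> _")
proof -
  define d where "d r x = norm (a - complex_of_real r * cis x)" for r x
  have "?I \<le> (\<integral>\<^sup>+x. ennreal (A * \<delta> * w / (d (1 - \<delta>) x)\<^sup>2) \<partial>uniform_angle)"
    by (intro nn_integral_mono ennreal_leI) (simp add: d_def mult.assoc)
  also have "\<dots> = ennreal (A * \<delta> * w / (1 - (1 - \<delta>)\<^sup>2))"
    unfolding d_def using \<delta> A w by (intro nn_integral_poisson_kernel a) auto
  also have "\<dots> \<le> ennreal (A * w)"
  proof (rule ennreal_leI)
    have "A * \<delta> * w / (1 - (1 - \<delta>)\<^sup>2) = A * w / (2 - \<delta>)"
      using \<delta> by (simp add: power2_eq_square field_simps)
    also have "\<dots> \<le> A * w / 1"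
      using \<delta> A w by (intro divide_left_mono) auto
    finally show "A * \<delta> * w / (1 - (1 - \<delta>)\<^sup>2) \<le> A * w" by simp
  qed
  finally have 1: "?I \<le> ennreal (A * w)" .
  \<comment> \<open>Compare with radius \<open>1 - s\<close>: either both distances are of order \<open>s\<close>, or they are comparable.\<close>
  define s where "s = sqrt \<delta>"
  have "sqrt \<delta> \<le> sqrt ((1 / 2)\<^sup>2)"
    using \<delta> by (intro real_sqrt_le_mono) (simp add: power2_eq_square)
  then have s: "0 < s" "s \<le> 1 / 2" "s\<^sup>2 = \<delta>"
    using \<delta> by (simp_all add: s_def)
  have "min 1 (A * (\<delta> * w / (d (1 - \<delta>) x)\<^sup>2)) \<le> 4 * A * \<delta> / (d (1 - s) x)\<^sup>2" for x
  proof -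
    have pos: "0 < d r x" if "0 < r" "r < 1" for r
    proof -
      have "norm (complex_of_real r * cis x) = r"
        using that by (simp add: norm_mult)
      then have "a \<noteq> complex_of_real r * cis x"
        using that a by auto
      then show ?thesis
        by (simp add: d_def)
    qed
    have "d (1 - s) x \<le> d (1 - \<delta>) x + norm (complex_of_real (s - \<delta>) * cis x)"
      using norm_triangle_ineq[of "a - complex_of_real (1 - \<delta>) * cis x" "complex_of_real (s - \<delta>) * cis x"]
      by (simp add: d_def algebra_simps)
    moreover have "norm (complex_of_real (s - \<delta>) * cis x) \<le> s"
    proof -
      have "\<delta> \<le> s"
        using s mult_right_mono[of s 1 s] by (simp add: power2_eq_square)
      then show ?thesis
        using \<delta> by (simp add: norm_mult del: of_real_diff)
    qed
    ultimately have tri: "d (1 - s) x \<le> d (1 - \<delta>) x + s"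
      by linarith
    have p: "0 < d (1 - s) x" "0 < d (1 - \<delta>) x"
      using pos s \<delta> by auto
    show ?thesis
    proof (cases "d (1 - \<delta>) x \<le> s")
      case True
      then have "(d (1 - s) x)\<^sup>2 \<le> (2 * s)\<^sup>2"
        using tri p by (intro power_mono) auto
      also have "\<dots> = 4 * \<delta>"
        using s by (simp add: power_mult_distrib)
      also have "\<dots> \<le> 4 * A * \<delta>"
        using A \<delta> by simp
      finally have "1 \<le> 4 * A * \<delta> / (d (1 - s) x)\<^sup>2"
        using p by (subst pos_le_divide_eq) auto
      then show ?thesis
        by linarith
    next
      case False
      then have "(d (1 - s) x)\<^sup>2 \<le> (2 * d (1 - \<delta>) x)\<^sup>2"
        using tri p by (intro power_mono) auto
      then have "(d (1 - s) x)\<^sup>2 \<le> 4 * (d (1 - \<delta>) x)\<^sup>2"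
        by (simp add: power_mult_distrib)
      have "A * (\<delta> * w / (d (1 - \<delta>) x)\<^sup>2) = 4 * (A * \<delta> * w) / (4 * (d (1 - \<delta>) x)\<^sup>2)"
        by simp
      also have "\<dots> \<le> 4 * (A * \<delta> * 1) / (d (1 - s) x)\<^sup>2"
        using \<open>(d (1 - s) x)\<^sup>2 \<le> 4 * (d (1 - \<delta>) x)\<^sup>2\<close> p A \<delta> w
        by (intro frac_le mult_left_mono) auto
      finally show ?thesis
        by (simp add: mult.assoc)
    qed
  qed
  then have "?I \<le> (\<integral>\<^sup>+x. ennreal (4 * A * \<delta> / (d (1 - s) x)\<^sup>2) \<partial>uniform_angle)"
    unfolding d_def by (intro nn_integral_mono ennreal_leI)
  also have "\<dots> = ennreal (4 * A * \<delta> / (1 - (1 - s)\<^sup>2))"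
    unfolding d_def using \<delta> s A w by (intro nn_integral_poisson_kernel a) auto
  also have "\<dots> \<le> ennreal (4 * A * s)"
  proof (rule ennreal_leI)
    have "4 * A * \<delta> / (1 - (1 - s)\<^sup>2) = 4 * A * s / (2 - s)"
      using s by (simp add: s(3)[symmetric] power2_eq_square field_simps)
    also have "\<dots> \<le> 4 * A * s / 1"
      using s A by (intro divide_left_mono) auto
    finally show "4 * A * \<delta> / (1 - (1 - s)\<^sup>2) \<le> 4 * A * s" by simp
  qed
  finally have 2: "?I \<le> ennreal (4 * A * s)" .
  show ?thesis
    using 1 2 by (simp add: min_def s_def)
qed

text \<open>A weak-type bound. As \<open>Re H \<ge> 0\<close>, the function \<open>1 / (1 + t * H)\<close> is analytic and bounded by \<open>1\<close>; its mean
  over the circle is its value at \<open>0\<close>, which is at least \<open>1 / (1 + t)\<close>. So it is close to \<open>1\<close> on most of the circle,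
  whereas it is small where \<open>t * \<bar>H\<bar>\<close> is large. The choice \<open>t = 3 / K\<close> makes its modulus less than \<open>1 / 2\<close>
  where \<open>\<bar>H\<bar> > K\<close>.\<close>

lemma (in circle_weights) herglotz_tightness:
  assumes total: "suminf c \<le> 1" and r: "0 < r" "r < 1" and K: "0 < K"
  shows "(\<integral>\<^sup>+x. indicator {x. K < norm (herglotz_sum c \<zeta> (complex_of_real r * cis x))} x \<partial>uniform_angle)
    \<le> ennreal (6 / K)"
proof -
  let ?H = "herglotz_sum c \<zeta>"
  define t where "t = 3 / K"
  define g where "g z = 1 / (1 + complex_of_real t * ?H z)" for z
  define f where "f z = 2 * (1 - g z)" for z
  have t: "0 < t" "t * K = 3"
    using K by (simp_all add: t_def)
  have ge1: "1 \<le> norm (1 + complex_of_real t * ?H z)" if "norm z < 1" for z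
  proof -
    have "1 \<le> Re (1 + complex_of_real t * ?H z)"
      using t Re_herglotz_nonneg[OF that] by simp
    then show ?thesis
      using abs_Re_le_cmod[of "1 + complex_of_real t * ?H z"] by linarith
  qed
  have Re_f: "2 - 2 / norm (1 + complex_of_real t * ?H z) \<le> Re (f z)" for z
  proof -
    have "norm (g z) = 1 / norm (1 + complex_of_real t * ?H z)"
      by (simp add: g_def norm_divide)
    then show ?thesis
      using complex_Re_le_cmod[of "g z"] by (simp add: f_def)
  qed
  have "(\<integral>\<^sup>+x. indicator {x. K < norm (?H (complex_of_real r * cis x))} x \<partial>uniform_angle)
      \<le> (\<integral>\<^sup>+x. ennreal (Re (f (complex_of_real r * cis x))) \<partial>uniform_angle)"
  proof (rule nn_integral_mono)
    fix x
    let ?z = "complex_of_real r * cis x"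
    have "1 \<le> Re (f ?z)" if "K < norm (?H ?z)"
    proof -
      have "3 \<le> t * norm (?H ?z)"
        using that t by (metis less_imp_le mult_left_mono)
      then have "2 \<le> norm (1 + complex_of_real t * ?H ?z)"
        using norm_triangle_ineq2[of "complex_of_real t * ?H ?z" "- 1"] t
        by (simp add: norm_mult add.commute)
      then have "2 / norm (1 + complex_of_real t * ?H ?z) \<le> 2 / 2"
        by (intro divide_left_mono) auto
      then show ?thesis
        using Re_f[of ?z] by linarith
    qed
    then show "indicator {x. K < norm (?H (complex_of_real r * cis x))} x \<le> ennreal (Re (f ?z))"
      by (auto simp: indicator_def)
  qed
  also have "\<dots> = ennreal (Re (f 0))"
  proof (rule nn_integral_circle_mean[OF _ r])
    show "f holomorphic_on ball 0 1"
      unfolding f_def g_def using ge1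
      by (intro holomorphic_intros holomorphic_herglotz_sum) fastforce
    show "0 \<le> Re (f z)" if "norm z < 1" for z
    proof -
      have "2 / norm (1 + complex_of_real t * ?H z) \<le> 2 / 1"
        using ge1[OF that] by (intro divide_left_mono) auto
      then show ?thesis
        using Re_f[of z] by linarith
    qed
  qed
  also have "\<dots> \<le> ennreal (6 / K)"
  proof (rule ennreal_leI)
    have s0: "0 \<le> suminf c"
      using weight_nonneg summable_weights by (intro suminf_nonneg)
    then have pos: "0 < 1 + t * suminf c"
      using t mult_nonneg_nonneg[of t "suminf c"] by linarith
    have "f 0 = complex_of_real (2 * (1 - 1 / (1 + t * suminf c)))"
      by (simp add: f_def g_def herglotz_0)
    then have "Re (f 0) = 2 * (1 - 1 / (1 + t * suminf c))"
      by simp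
    also have "\<dots> = 2 * (t * suminf c) / (1 + t * suminf c)"
      using pos by (simp add: field_simps)
    also have "\<dots> \<le> 2 * (t * suminf c) / 1"
      using t s0 pos by (intro divide_left_mono) auto
    also have "\<dots> \<le> 2 * t"
      using t total by simp
    also have "\<dots> = 6 / K"
      by (simp add: t_def)
    finally show "Re (f 0) \<le> 6 / K" .
  qed
  finally show ?thesis .
qed

text \<open>Truncating the terms at \<open>1\<close> does not lose the event that the sum is at least \<open>1\<close>. The sum of the
  untruncated means need not tend to \<open>0\<close>, but the sum of the truncated ones does.\<close>

lemma one_le_suminf_truncated:
  fixes y :: "nat \<Rightarrow> real"
  assumes "summable y" "\<And>m. 0 \<le> y m" "1 \<le> suminf y"
  shows "1 \<le> (\<Sum>m. ennreal (min 1 (y m)))"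
proof (cases "\<exists>m. 1 \<le> y m")
  case True
  then obtain m where "1 \<le> y m" ..
  then have "1 = (\<Sum>k\<in>{m}. ennreal (min 1 (y k)))"
    by (simp add: min_def)
  also have "\<dots> \<le> (\<Sum>m. ennreal (min 1 (y m)))"
    by (intro sum_le_suminf) auto
  finally show ?thesis .
next
  case False
  then have "min 1 (y m) = y m" for m
    by (metis min.absorb2 nle_le)
  then have "(\<Sum>m. ennreal (min 1 (y m))) = (\<Sum>m. ennreal (y m))"
    by simp
  also have "\<dots> = ennreal (suminf y)"
    by (rule suminf_ennreal2[OF assms(2,1)])
  finally show ?thesis
    using assms(3) by simp
qed

text \<open>Moving the \<open>n\<close>-th atom only moves the base point, because the other two ingredients see the \<open>n\<close>-th atom
  with weight \<open>0\<close>.\<close>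

lemma good_atom_fun_upd:
  assumes "c n \<le> 1 / 4"
  shows "good_atom K c (\<zeta>(n := u)) n \<longleftrightarrow>
    isolation_const K * (\<Sum>m. c n * (c(n := 0)) m / (norm (\<zeta> m - complex_of_real (1 - c n) * u))\<^sup>2) \<le> 1 \<and>
    norm (herglotz_sum (c(n := 0)) \<zeta> (complex_of_real (1 - c n) * u)) \<le> K"
proof -
  have "interaction c (\<zeta>(n := u)) n =
      (\<Sum>m. c n * (c(n := 0)) m / (norm (\<zeta> m - complex_of_real (1 - c n) * u))\<^sup>2)"
    unfolding interaction_def base_point_def by (intro suminf_cong) auto
  moreover have "herglotz_sum (c(n := 0)) (\<zeta>(n := u)) z = herglotz_sum (c(n := 0)) \<zeta> z" for z
    unfolding herglotz_sum_def by (intro suminf_cong) auto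
  ultimately show ?thesis
    using assms by (simp add: good_atom_def base_point_def)
qed

text \<open>A bound for the probability that the \<open>n\<close>-th atom is not good: the series accounts for a lack of isolation,
  the constant for a large Herglotz transform.\<close>

definition failure_bound :: "real \<Rightarrow> (nat \<Rightarrow> real) \<Rightarrow> nat \<Rightarrow> real"
  where "failure_bound K c n =
    (\<Sum>m. min (isolation_const K * c m) (4 * isolation_const K * sqrt (c n))) + 6 / K"

lemma (in circle_weights) summable_failure_bound:
  "0 \<le> K \<Longrightarrow> summable (\<lambda>m. min (isolation_const K * c m) (4 * isolation_const K * sqrt (c n)))"
  using isolation_const_ge(2)[of K] weight_nonneg
  by (intro summable_comparison_test'[OF summable_mult[OF summable_weights, of "isolation_const K"]])
    (auto simp: min_def)

text \<open>Tannery's theorem with the weights as summable majorant: each single term vanishes in the limit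
  because \<open>c n\<close> tends to \<open>0\<close>.\<close>

lemma failure_bound_tendsto:
  assumes pos: "\<And>n. 0 < c n" and sm: "summable c" and K: "0 < K"
  shows "failure_bound K c \<longlonglongrightarrow> 6 / K"
proof -
  have A: "1 \<le> isolation_const K"
    using K by (intro isolation_const_ge) simp
  have "(\<lambda>n. \<Sum>m. min (isolation_const K * c m) (4 * isolation_const K * sqrt (c n)))
      \<longlonglongrightarrow> (\<Sum>m. 0)"
  proof (rule tannerys_theorem[THEN conjunct2, THEN conjunct2])
    fix m
    have "(\<lambda>n. min (isolation_const K * c m) (4 * isolation_const K * sqrt (c n)))
        \<longlonglongrightarrow> min (isolation_const K * c m) (4 * isolation_const K * sqrt 0)"
      by (intro tendsto_intros summable_LIMSEQ_zero sm)
    then show "(\<lambda>n. min (isolation_const K * c m) (4 * isolation_const K * sqrt (c n))) \<longlonglongrightarrow> 0"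
      using A pos[of m] by (simp add: min_def mult_le_0_iff split: if_splits)
  next
    show "summable (\<lambda>m. isolation_const K * c m)"
      by (rule summable_mult[OF sm])
    show "\<forall>\<^sub>F (m, n) in at_top \<times>\<^sub>F at_top.
        norm (min (isolation_const K * c m) (4 * isolation_const K * sqrt (c n))) \<le> isolation_const K * c m"
    proof (intro always_eventually allI, clarify)
      fix m n
      have "0 \<le> isolation_const K * c m" "0 \<le> 4 * isolation_const K * sqrt (c n)"
        using A pos[of m] pos[of n] by auto
      then show "norm (min (isolation_const K * c m) (4 * isolation_const K * sqrt (c n)))
          \<le> isolation_const K * c m"
        unfolding real_norm_def by linarith
    qed
  qed simp
  then have "failure_bound K c \<longlonglongrightarrow> 0 + 6 / K"
    unfolding failure_bound_def[abs_def] by (intro tendsto_intros) simp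
  then show ?thesis by simp
qed

text \<open>All atoms but the \<open>n\<close>-th one are held fixed, in arbitrary position; only the angle \<open>x\<close> of the \<open>n\<close>-th
  one is averaged.\<close>

lemma (in circle_weights) nn_integral_not_good_atom:
  assumes total: "suminf c = 1" and cn: "0 < c n" "c n \<le> 1 / 4" and K: "0 < K"
  shows "(\<integral>\<^sup>+x. indicator {x. \<not> good_atom K c (\<zeta>(n := cis x)) n} x \<partial>uniform_angle)
    \<le> ennreal (failure_bound K c n)"
proof -
  interpret rest: circle_weights "c(n := 0)" \<zeta>
    by (rule circle_weights_remove)
  define A where "A = isolation_const K"
  have A: "1 \<le> A"
    using K unfolding A_def by (intro isolation_const_ge) simp
  define z where "z x = complex_of_real (1 - c n) * cis x" for x
  have norm_z: "norm (z x) = 1 - c n" for x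
    using cn by (simp add: z_def norm_mult del: of_real_diff)
  define y where "y m x = c n * (c(n := 0)) m / (norm (\<zeta> m - z x))\<^sup>2" for m x
  have y_nonneg: "0 \<le> y m x" for m x
    using cn rest.weight_nonneg unfolding y_def by (intro divide_nonneg_nonneg mult_nonneg_nonneg) auto
  have y_summable: "summable (\<lambda>m. y m x)" for x
    unfolding y_def using cn by (intro rest.summable_weighted_inverse_square) (simp add: norm_z)
  have [measurable]: "(\<lambda>x. y m x) \<in> borel_measurable borel" for m
    unfolding y_def z_def by measurable
  have [measurable]: "(\<lambda>x. herglotz_sum (c(n := 0)) \<zeta> (z x)) \<in> borel_measurable borel"
    unfolding herglotz_sum_def z_def by measurable
  have "indicator {x. \<not> good_atom K c (\<zeta>(n := cis x)) n} x
      \<le> (\<Sum>m. ennreal (min 1 (A * y m x))) + indicator {x. K < norm (herglotz_sum (c(n := 0)) \<zeta> (z x))} x"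
    for x
  proof (cases "1 < A * (\<Sum>m. y m x)")
    case True
    have "1 \<le> (\<Sum>m. ennreal (min 1 (A * y m x)))"
      using True A y_nonneg y_summable
      by (intro one_le_suminf_truncated summable_mult) (auto simp: suminf_mult)
    then show ?thesis
      by (auto simp: indicator_def intro: order_trans add_increasing2)
  next
    case False
    then show ?thesis
      unfolding good_atom_fun_upd[of c n, OF cn(2)]
      by (auto simp: indicator_def A_def y_def z_def not_less)
  qed
  then have "(\<integral>\<^sup>+x. indicator {x. \<not> good_atom K c (\<zeta>(n := cis x)) n} x \<partial>uniform_angle)
      \<le> (\<integral>\<^sup>+x. (\<Sum>m. ennreal (min 1 (A * y m x)))
        + indicator {x. K < norm (herglotz_sum (c(n := 0)) \<zeta> (z x))} x \<partial>uniform_angle)"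
    by (intro nn_integral_mono)
  also have "\<dots> = (\<Sum>m. \<integral>\<^sup>+x. ennreal (min 1 (A * y m x)) \<partial>uniform_angle)
      + (\<integral>\<^sup>+x. indicator {x. K < norm (herglotz_sum (c(n := 0)) \<zeta> (z x))} x \<partial>uniform_angle)"
    by (subst nn_integral_add) (auto simp: nn_integral_suminf)
  also have "\<dots> \<le> (\<Sum>m. ennreal (min (A * c m) (4 * A * sqrt (c n)))) + ennreal (6 / K)"
  proof (intro add_mono suminf_le)
    fix m
    have "(c(n := 0)) m \<le> 1"
      using sum_le_suminf[OF summable_weights, of "{m}"] weight_nonneg total by simp
    then have "(\<integral>\<^sup>+x. ennreal (min 1 (A * y m x)) \<partial>uniform_angle)
        \<le> ennreal (min (A * (c(n := 0)) m) (4 * A * sqrt (c n)))"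
      unfolding y_def z_def using cn A rest.weight_nonneg
      by (intro nn_integral_truncated_interaction norm_atom) auto
    also have "\<dots> \<le> ennreal (min (A * c m) (4 * A * sqrt (c n)))"
      using A weight_nonneg[of m] by (intro ennreal_leI min.mono mult_left_mono) auto
    finally show "(\<integral>\<^sup>+x. ennreal (min 1 (A * y m x)) \<partial>uniform_angle)
        \<le> ennreal (min (A * c m) (4 * A * sqrt (c n)))" .
  next
    show "(\<integral>\<^sup>+x. indicator {x. K < norm (herglotz_sum (c(n := 0)) \<zeta> (z x))} x \<partial>uniform_angle)
        \<le> ennreal (6 / K)"
      unfolding z_def using cn K total suminf_remove[of n]
      by (intro rest.herglotz_tightness) auto
  qed auto
  also have "(\<Sum>m. ennreal (min (A * c m) (4 * A * sqrt (c n))))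
      = ennreal (\<Sum>m. min (A * c m) (4 * A * sqrt (c n)))"
    using summable_failure_bound[of K n] K A weight_nonneg
    by (intro suminf_ennreal2) (auto simp: A_def)
  also have "\<dots> + ennreal (6 / K) = ennreal (failure_bound K c n)"
    unfolding failure_bound_def A_def[symmetric] using K A weight_nonneg summable_failure_bound[of K n]
    by (intro ennreal_plus[symmetric] suminf_nonneg) (auto simp: A_def)
  finally show ?thesis .
qed

section \<open>Almost sure divergence\<close>

lemma measurable_good_atom:
  assumes [measurable]: "\<And>m. (\<lambda>\<omega>. \<zeta> \<omega> m) \<in> borel_measurable N"
  shows "Measurable.pred N (\<lambda>\<omega>. good_atom K c (\<zeta> \<omega>) n)"
  unfolding good_atom_def interaction_def herglotz_sum_def base_point_def by measurable

text \<open>By independence the \<open>n\<close>-th angle may be averaged first. The bound of the inner integral does not depend on the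
  other angles.\<close>

lemma (in prob_space) emeasure_not_good_atom_le:
  assumes indep: "indep_vars (\<lambda>_. borel) \<theta> UNIV"
    and distr: "distr M borel (\<theta> n) = uniform_angle"
    and pos: "\<And>m. 0 < c m" and total: "c sums 1" and cn: "c n \<le> 1 / 4" and K: "0 < K"
  shows "emeasure M {\<omega> \<in> space M. \<not> good_atom K c (\<lambda>m. cis (\<theta> m \<omega>)) n} \<le> ennreal (failure_bound K c n)"
proof -
  let ?P = "Pi\<^sub>M (- {n}) (\<lambda>_. borel :: real measure)"
  let ?Q = "Pi\<^sub>M {n} (\<lambda>_. borel :: real measure)"
  \<comment> \<open>A one-coordinate product instead of a real variable, since both halves of an independent pair
    must have the same type.\<close>
  define X where "X \<omega> = (\<lambda>m\<in>{n}. \<theta> m \<omega>)" for \<omega>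
  define T where "T \<omega> = (\<lambda>m\<in>- {n}. \<theta> m \<omega>)" for \<omega>
  define b where "b x y = (indicator {x. \<not> good_atom K c ((\<lambda>m. cis (y m))(n := cis x)) n} x :: ennreal)"
    for x y
  have rv [measurable]: "random_variable borel (\<theta> m)" for m
    using indep by (auto simp: indep_vars_def)
  have X [measurable]: "X \<in> measurable M ?Q"
    unfolding X_def by measurable
  have T [measurable]: "T \<in> measurable M ?P"
    unfolding T_def by measurable
  have "indep_var ?Q X ?P T"
    unfolding X_def T_def by (rule indep_var_restrict[OF indep]) auto
  then have joint: "distr M ?Q X \<Otimes>\<^sub>M distr M ?P T = distr M (?Q \<Otimes>\<^sub>M ?P) (\<lambda>\<omega>. (X \<omega>, T \<omega>))"
    by (simp add: indep_var_distribution_eq)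
  interpret Q: prob_space "distr M ?Q X"
    by (rule prob_space_distr) (rule X)
  interpret PT: prob_space "distr M ?P T"
    by (rule prob_space_distr) (rule T)
  interpret pair_sigma_finite "distr M ?Q X" "distr M ?P T" ..
  have "Measurable.pred (borel \<Otimes>\<^sub>M ?P) (\<lambda>p. good_atom K c ((\<lambda>m. cis (snd p m))(n := cis (fst p))) n)"
  proof (rule measurable_good_atom)
    fix m
    show "(\<lambda>p. ((\<lambda>m. cis (snd p m))(n := cis (fst p))) m) \<in> borel_measurable (borel \<Otimes>\<^sub>M ?P)"
    proof (cases "m = n")
      case False
      then have "m \<in> - {n}" by simp
      then have "(\<lambda>p. cis (snd p m)) \<in> borel_measurable (borel \<Otimes>\<^sub>M ?P)"
        by measurable
      then show ?thesis
        using False by simp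
    qed simp
  qed
  then have b_meas [measurable]: "(\<lambda>p. b (fst p) (snd p)) \<in> borel_measurable (borel \<Otimes>\<^sub>M ?P)"
    unfolding b_def indicator_def by simp
  have same: "(\<lambda>m. cis (T \<omega> m))(n := cis (X \<omega> n)) = (\<lambda>m. cis (\<theta> m \<omega>))" for \<omega>
    by (auto simp: T_def X_def)
  have [measurable]: "{\<omega> \<in> space M. \<not> good_atom K c (\<lambda>m. cis (\<theta> m \<omega>)) n} \<in> sets M"
    using measurable_good_atom[of "\<lambda>\<omega> m. cis (\<theta> m \<omega>)" M K c n] by measurable
  have b_meas_Q [measurable]: "(\<lambda>p. b (fst p n) (snd p)) \<in> borel_measurable (?Q \<Otimes>\<^sub>M ?P)"
  proof -
    have "(\<lambda>p. (fst p n, snd p)) \<in> measurable (?Q \<Otimes>\<^sub>M ?P) (borel \<Otimes>\<^sub>M ?P)"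
      by measurable
    from measurable_compose[OF this b_meas] show ?thesis
      by simp
  qed
  have "emeasure M {\<omega> \<in> space M. \<not> good_atom K c (\<lambda>m. cis (\<theta> m \<omega>)) n}
      = (\<integral>\<^sup>+\<omega>. indicator {\<omega> \<in> space M. \<not> good_atom K c (\<lambda>m. cis (\<theta> m \<omega>)) n} \<omega> \<partial>M)"
    by simp
  also have "\<dots> = (\<integral>\<^sup>+\<omega>. b (X \<omega> n) (T \<omega>) \<partial>M)"
    unfolding b_def by (intro nn_integral_cong) (simp add: indicator_def same)
  also have "\<dots> = (\<integral>\<^sup>+p. b (fst p n) (snd p) \<partial>distr M (?Q \<Otimes>\<^sub>M ?P) (\<lambda>\<omega>. (X \<omega>, T \<omega>)))"
    by (subst nn_integral_distr) auto
  also have "\<dots> = (\<integral>\<^sup>+p. b (fst p n) (snd p) \<partial>(distr M ?Q X \<Otimes>\<^sub>M distr M ?P T))"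
    by (simp only: joint)
  also have "\<dots> = (\<integral>\<^sup>+y. \<integral>\<^sup>+x. b (x n) y \<partial>distr M ?Q X \<partial>distr M ?P T)"
    using nn_integral_snd[of "\<lambda>p. b (fst p n) (snd p)"] by simp
  also have "\<dots> = (\<integral>\<^sup>+y. \<integral>\<^sup>+x. b x y \<partial>uniform_angle \<partial>distr M ?P T)"
  proof (rule nn_integral_cong)
    fix y assume "y \<in> space (distr M ?P T)"
    then have y: "y \<in> space ?P" by simp
    have [measurable]: "(\<lambda>x. b x y) \<in> borel_measurable borel"
      using measurable_compose[OF measurable_Pair2'[OF y] b_meas] by simp
    have "(\<integral>\<^sup>+x. b (x n) y \<partial>distr M ?Q X) = (\<integral>\<^sup>+\<omega>. b (X \<omega> n) y \<partial>M)"
      by (subst nn_integral_distr) auto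
    also have "\<dots> = (\<integral>\<^sup>+x. b x y \<partial>distr M borel (\<theta> n))"
      by (subst nn_integral_distr) (auto simp: X_def)
    finally show "(\<integral>\<^sup>+x. b (x n) y \<partial>distr M ?Q X) = (\<integral>\<^sup>+x. b x y \<partial>uniform_angle)"
      by (simp add: distr)
  qed
  also have "\<dots> \<le> (\<integral>\<^sup>+y. ennreal (failure_bound K c n) \<partial>distr M ?P T)"
  proof (rule nn_integral_mono)
    fix y
    interpret circle_weights c "\<lambda>m. cis (y m)"
      using pos total by unfold_locales (auto simp: less_imp_le sums_iff)
    show "(\<integral>\<^sup>+x. b x y \<partial>uniform_angle) \<le> ennreal (failure_bound K c n)"
      unfolding b_def using total pos cn K by (intro nn_integral_not_good_atom) (auto simp: sums_iff)
  qed
  also have "\<dots> = ennreal (failure_bound K c n)"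
    using PT.emeasure_space_1 by simp
  finally show ?thesis .
qed

text \<open>If the series stays below \<open>L\<close> on an event of probability larger than \<open>\<eta>\<close>, then each late \<open>G n\<close> meets this event
  with probability at least the excess. Integrating the series over the event bounds the partial sums
  of \<open>a\<close>.\<close>

lemma (in prob_space) prob_weighted_series_finite_le:
  fixes a :: "nat \<Rightarrow> real"
  assumes G [measurable]: "\<And>n. G n \<in> events"
    and likely: "\<And>n. N \<le> n \<Longrightarrow> prob (space M - G n) \<le> \<eta>"
    and a: "\<And>n. 0 \<le> a n" "\<not> summable a"
  shows "prob {\<omega> \<in> space M. (\<Sum>n. ennreal (a n) * indicator (G n) \<omega>) \<noteq> \<infinity>} \<le> \<eta>"
proof -
  define S where "S \<omega> = (\<Sum>n. ennreal (a n) * indicator (G n) \<omega>)" for \<omega>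
  have [measurable]: "S \<in> borel_measurable M"
    unfolding S_def by measurable
  define D where "D L = {\<omega> \<in> space M. S \<omega> \<le> of_nat L}" for L :: nat
  have [measurable]: "D L \<in> events" for L
    unfolding D_def by measurable
  have D_le: "prob (D L) \<le> \<eta>" for L
  proof (rule ccontr)
    assume "\<not> prob (D L) \<le> \<eta>"
    then have gap: "0 < prob (D L) - \<eta>" by simp
    have "(\<Sum>n<k. a (n + N)) \<le> L / (prob (D L) - \<eta>)" for k
    proof -
      have "(\<Sum>n<k. a (n + N) * prob (D L \<inter> G (n + N)))
          = expectation (\<lambda>\<omega>. \<Sum>n<k. a (n + N) * indicator (D L \<inter> G (n + N)) \<omega>)"
        by (subst Bochner_Integration.integral_sum) (auto simp: emeasure_eq_measure)
      also have "\<dots> \<le> expectation (\<lambda>\<omega>. real L)"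
      proof (rule integral_mono)
        fix \<omega> assume "\<omega> \<in> space M"
        show "(\<Sum>n<k. a (n + N) * indicator (D L \<inter> G (n + N)) \<omega>) \<le> real L"
        proof (cases "\<omega> \<in> D L")
          case True
          have "ennreal (\<Sum>n<k. a (n + N) * indicator (G (n + N)) \<omega>)
              = (\<Sum>n<k. ennreal (a (n + N)) * indicator (G (n + N)) \<omega>)"
            using a by (subst sum_ennreal[symmetric]) (auto simp: ennreal_mult ennreal_indicator)
          also have "\<dots> = (\<Sum>n\<in>(\<lambda>n. n + N) ` {..<k}. ennreal (a n) * indicator (G n) \<omega>)"
            by (subst sum.reindex) auto
          also have "\<dots> \<le> S \<omega>"
            unfolding S_def by (intro sum_le_suminf) auto
          also have "\<dots> \<le> ennreal (real L)"
            using True by (simp add: D_def ennreal_of_nat_eq_real_of_nat)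
          finally show ?thesis
            using True by (simp add: indicator_def)
        qed simp
      next
        show "integrable M (\<lambda>\<omega>. \<Sum>n<k. a (n + N) * indicator (D L \<inter> G (n + N)) \<omega>)"
          by (intro Bochner_Integration.integrable_sum integrable_mult_right integrable_real_indicator)
            (auto simp: emeasure_eq_measure)
      qed simp
      also have "\<dots> = L"
        by (simp add: prob_space)
      finally have 1: "(\<Sum>n<k. a (n + N) * prob (D L \<inter> G (n + N))) \<le> L" .
      have 2: "a (n + N) * (prob (D L) - \<eta>) \<le> a (n + N) * prob (D L \<inter> G (n + N))" for n
      proof (rule mult_left_mono)
        have "prob (D L) \<le> prob ((D L \<inter> G (n + N)) \<union> (space M - G (n + N)))"
          by (rule finite_measure_mono) (auto simp: D_def)
        also have "\<dots> \<le> prob (D L \<inter> G (n + N)) + prob (space M - G (n + N))"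
          by (rule measure_Un_le) auto
        finally show "prob (D L) - \<eta> \<le> prob (D L \<inter> G (n + N))"
          using likely[of "n + N"] by simp
      qed (rule a)
      have "(\<Sum>n<k. a (n + N)) * (prob (D L) - \<eta>) \<le> L"
        unfolding sum_distrib_right using sum_mono[of "{..<k}", OF 2] 1 by (rule order_trans)
      then show ?thesis
        using gap by (simp add: pos_le_divide_eq)
    qed
    then have "summable (\<lambda>n. a (n + N))"
      using a by (intro summableI_nonneg_bounded) auto
    then show False
      using a(2) by (simp add: summable_iff_shift)
  qed
  have "incseq D"
    unfolding D_def incseq_def by (auto elim: order_trans)
  then have "(\<lambda>L. prob (D L)) \<longlonglongrightarrow> prob (\<Union>L. D L)"
    by (intro finite_Lim_measure_incseq) auto
  then have "prob (\<Union>L. D L) \<le> \<eta>"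
    by (rule LIMSEQ_le_const2) (use D_le in auto)
  also have "(\<Union>L. D L) = {\<omega> \<in> space M. S \<omega> \<noteq> \<infinity>}"
  proof -
    have "\<exists>L :: nat. S \<omega> \<le> of_nat L" if fin: "S \<omega> \<noteq> \<infinity>" for \<omega>
    proof -
      obtain L :: nat where "S \<omega> < of_nat L"
        using fin ennreal_Ex_less_of_nat[of "S \<omega>"] by (auto simp: less_top)
      then show ?thesis
        by (intro exI[of _ L] less_imp_le)
    qed
    then show ?thesis
      by (auto simp: D_def top_unique)
  qed
  finally show ?thesis
    by (simp add: S_def)
qed

text \<open>With \<open>x = p + \<epsilon>\<close> the weights eventually exceed \<open>n\<close> to the power \<open>- x\<close>, and \<open>x * (2 - x) \<le> 1\<close>; this
  gives a comparison with the harmonic series. For \<open>x > 2\<close> the terms do not even tend to \<open>0\<close>.\<close>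

lemma not_summable_powr:
  fixes c :: "nat \<Rightarrow> real" and p \<epsilon> :: real
  assumes c: "\<And>n. 0 < c n" "\<And>n. c n \<le> 1"
    and lim: "(\<lambda>n. - ln (c n) / ln (real n)) \<longlonglongrightarrow> p" and \<epsilon>: "0 < \<epsilon>"
  shows "\<not> summable (\<lambda>n. c n powr (2 - p - \<epsilon>))"
proof
  assume sm: "summable (\<lambda>n. c n powr (2 - p - \<epsilon>))"
  define x where "x = p + \<epsilon>"
  have ev: "\<forall>\<^sub>F n in sequentially. - ln (c n) / ln (real n) < x"
    using lim \<epsilon> by (intro order_tendstoD) (auto simp: x_def)
  have "\<forall>\<^sub>F n in sequentially. norm (inverse (of_nat n) :: real) \<le> c n powr (2 - x)"
    using ev eventually_ge_at_top[of 2]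
  proof eventually_elim
    case (elim n)
    then have ln_n: "0 < ln (real n)" by simp
    have le: "- ln (c n) \<le> x * ln (real n)"
      using elim(1) unfolding pos_divide_less_eq[OF ln_n] by (rule less_imp_le)
    have ln_c: "ln (c n) \<le> 0"
      using c[of n] by simp
    have "- ln (real n) \<le> (2 - x) * ln (c n)"
    proof (cases "0 \<le> 2 - x")
      case True
      have "0 \<le> (x - 1)\<^sup>2" by simp
      then have "(2 - x) * x \<le> 1"
        by (simp add: power2_eq_square algebra_simps)
      then have "(2 - x) * x * ln (real n) \<le> 1 * ln (real n)"
        using ln_n by (intro mult_right_mono) auto
      moreover have "(2 - x) * (- ln (c n)) \<le> (2 - x) * (x * ln (real n))"
        using le True by (rule mult_left_mono)
      ultimately show ?thesis
        by (simp add: mult.assoc)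
    next
      case False
      then have "0 \<le> (2 - x) * ln (c n)"
        using ln_c by (intro mult_nonpos_nonpos) auto
      then show ?thesis
        using ln_n by linarith
    qed
    then have "exp (- ln (real n)) \<le> exp ((2 - x) * ln (c n))"
      by simp
    then show ?case
      using elim c(1)[of n] by (simp add: powr_def exp_minus)
  qed
  moreover have "2 - p - \<epsilon> = 2 - x"
    by (simp add: x_def)
  with sm have "summable (\<lambda>n. c n powr (2 - x))"
    by (simp only:)
  ultimately have "summable (\<lambda>n. inverse (of_nat n) :: real)"
    by (rule summable_comparison_test_ev)
  with not_summable_harmonic show False
    by (rule notE)
qed

theorem theorem1p5:
  fixes M :: "'a measure" and c :: "nat \<Rightarrow> real" and p :: real
    and \<theta> :: "nat \<Rightarrow> 'a \<Rightarrow> real" and \<phi> :: "'a \<Rightarrow> complex \<Rightarrow> complex"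
  assumes "prob_space M"
    and "\<And>n. c n > 0" and "decseq c" and "c sums 1"
    and "(\<lambda>n. - ln (c n) / ln (real n)) \<longlonglongrightarrow> p" and "p \<ge> 1"
    and "prob_space.indep_vars M (\<lambda>_. borel) \<theta> UNIV"
    and "\<And>n. distr M borel (\<theta> n) = uniform_measure lborel {0..<2 * pi}"
    and "\<And>\<omega>. \<phi> \<omega> = inner_of (atomic_measure c (\<lambda>n. cis (\<theta> n \<omega>)))"
  shows "\<forall>\<epsilon>>0. AE \<omega> in M.
    (\<exists>\<Lambda>. zero_sequence (\<phi> \<omega>) \<Lambda>) \<and>
    (\<forall>\<Lambda>. zero_sequence (\<phi> \<omega>) \<Lambda> \<longrightarrow>
      (\<Sum>k. ennreal ((1 - norm (\<Lambda> k)) powr (2 - p - \<epsilon>))) = \<infinity>)"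
proof (intro allI impI)
  fix \<epsilon> :: real
  assume \<epsilon>: "0 < \<epsilon>"
  interpret prob_space M by fact
  have sm: "summable c" and total: "suminf c = 1"
    using \<open>c sums 1\<close> by (auto simp: sums_iff)
  have c_le: "c n \<le> 1" for n
    using sum_le_suminf[OF sm, of "{n}"] assms(2) total by (simp add: less_imp_le)
  define a where "a n = c n powr (2 - p - \<epsilon>)" for n
  have a: "\<not> summable a"
    unfolding a_def[abs_def] using assms(2,5) c_le \<epsilon> by (intro not_summable_powr)
  define G where "G K n = {\<omega> \<in> space M. good_atom K c (\<lambda>m. cis (\<theta> m \<omega>)) n}" for K n
  have [measurable]: "\<theta> n \<in> borel_measurable M" for n
    using assms(7) by (auto simp: indep_vars_def)
  have G [measurable]: "G K n \<in> events" for K n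
    unfolding G_def using measurable_good_atom[of "\<lambda>\<omega> m. cis (\<theta> m \<omega>)" M K c n] by measurable
  \<comment> \<open>The event that the good atoms at level \<open>K\<close> do not carry a divergent series has probability
    at most \<open>7 / K\<close>, so almost surely it fails for some \<open>K\<close>.\<close>
  define F where "F K = {\<omega> \<in> space M. (\<Sum>n. ennreal (a n) * indicator (G K n) \<omega>) \<noteq> \<infinity>}" for K
  have F [measurable]: "F K \<in> events" for K
    unfolding F_def by measurable
  have F_le: "prob (F K) \<le> 7 / K" if K: "0 < K" for K
  proof -
    have "\<forall>\<^sub>F n in sequentially. failure_bound K c n < 7 / K"
      using failure_bound_tendsto[OF assms(2) sm K] K
      by (intro order_tendstoD) (auto simp: divide_strict_right_mono)
    moreover have "\<forall>\<^sub>F n in sequentially. c n < 1 / 4"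
      using summable_LIMSEQ_zero[OF sm] by (intro order_tendstoD) auto
    ultimately have "\<forall>\<^sub>F n in sequentially. prob (space M - G K n) \<le> 7 / K"
    proof eventually_elim
      case (elim n)
      have "space M - G K n = {\<omega> \<in> space M. \<not> good_atom K c (\<lambda>m. cis (\<theta> m \<omega>)) n}"
        by (auto simp: G_def)
      then have "emeasure M (space M - G K n) \<le> ennreal (failure_bound K c n)"
        using emeasure_not_good_atom_le[OF assms(7,8,2,4)] elim K by simp
      also have "\<dots> \<le> ennreal (7 / K)"
        using elim by (intro ennreal_leI) simp
      finally show ?case
        using K by (simp add: emeasure_eq_measure)
    qed
    then obtain N where N: "\<And>n. N \<le> n \<Longrightarrow> prob (space M - G K n) \<le> 7 / K"
      by (auto simp: eventually_sequentially)
    then show ?thesis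
      unfolding F_def
      by (intro prob_weighted_series_finite_le[where N = N, OF G N _ a]) (simp_all add: a_def)
  qed
  have "prob (\<Inter>j. F (real (Suc j))) \<le> 0"
  proof (rule LIMSEQ_le_const)
    show "(\<lambda>j. 7 / real (Suc j)) \<longlonglongrightarrow> 0"
      by (rule LIMSEQ_Suc) (rule lim_const_over_n)
    have "prob (\<Inter>j. F (real (Suc j))) \<le> prob (F (real (Suc k)))" for k
      by (rule finite_measure_mono) auto
    then show "\<exists>N. \<forall>n\<ge>N. prob (\<Inter>j. F (real (Suc j))) \<le> 7 / real (Suc n)"
      using F_le by (meson of_nat_0_less_iff order_trans zero_less_Suc)
  qed
  then have "(\<Inter>j. F (real (Suc j))) \<in> null_sets M"
    by (intro null_setsI) (auto simp: emeasure_eq_measure measure_le_0_iff)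
  then show "AE \<omega> in M. (\<exists>\<Lambda>. zero_sequence (\<phi> \<omega>) \<Lambda>) \<and>
      (\<forall>\<Lambda>. zero_sequence (\<phi> \<omega>) \<Lambda> \<longrightarrow>
        (\<Sum>k. ennreal ((1 - norm (\<Lambda> k)) powr (2 - p - \<epsilon>))) = \<infinity>)"
  proof (rule AE_I', intro subsetI INT_I)
    fix \<omega> :: 'a and j :: nat
    assume \<omega>: "\<omega> \<in> {\<omega> \<in> space M. \<not> ((\<exists>\<Lambda>. zero_sequence (\<phi> \<omega>) \<Lambda>) \<and>
      (\<forall>\<Lambda>. zero_sequence (\<phi> \<omega>) \<Lambda> \<longrightarrow>
        (\<Sum>k. ennreal ((1 - norm (\<Lambda> k)) powr (2 - p - \<epsilon>))) = \<infinity>))}"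
    interpret circle_weights c "\<lambda>m. cis (\<theta> m \<omega>)"
      using assms(2) sm by unfold_locales (auto simp: less_imp_le)
    have "indicator (G (real (Suc j)) n) \<omega> =
        (indicator {n. good_atom (real (Suc j)) c (\<lambda>m. cis (\<theta> m \<omega>)) n} n :: ennreal)" for n
      using \<omega> by (simp add: G_def indicator_def)
    then have eq: "(\<Sum>n. ennreal (a n) * indicator (G (real (Suc j)) n) \<omega>) = (\<Sum>n. ennreal (c n powr (2 - p - \<epsilon>))
        * indicator {n. good_atom (real (Suc j)) c (\<lambda>m. cis (\<theta> m \<omega>)) n} n)"
      unfolding a_def by (intro suminf_cong) simp
    have "(\<Sum>n. ennreal (a n) * indicator (G (real (Suc j)) n) \<omega>) \<noteq> \<infinity>"
    proof
      assume "(\<Sum>n. ennreal (a n) * indicator (G (real (Suc j)) n) \<omega>) = \<infinity>"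
      then show False
        using zeros_diverge_of_good_atoms[OF total assms(2) of_nat_0_le_iff, of "2 - p - \<epsilon>" "Suc j"] \<omega>
        unfolding eq assms(9)[symmetric] by blast
    qed
    then show "\<omega> \<in> F (real (Suc j))"
      using \<omega> by (simp add: F_def)
  qed
qed

end
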